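(* Let $(\mathfrak{A}[\tau],\mathfrak{A}_0)$ be a locally convex quasi GA*-algebra with unit, and let $\mathcal{M}\subset \mathcal{I}_{\mathfrak{A}_0}(\mathfrak{A})$ be a strongly well-behaved family such that $\tau$ is equivalent to the topology $\tau^{\mathfrak{F}}_*$ defined by $\mathcal{M}$. Then: (a) every $\varphi\in\mathcal{M}$ is jointly $\tau$-continuous, i.e. there is a $\tau$-continuous seminorm $p$ on $\mathfrak{A}$ with $|\varphi(a,b)|\le p(a)p(b)$ for all $a,b\in\mathfrak{A}$; (b) every $\mathcal{M}$-regular *-representation $\pi$ of $(\mathfrak{A},\mathfrak{A}_0)$ is continuous from $\mathfrak{A}[\tau]$ into $\mathcal{L}^\dagger(\mathcal{D}_\pi,\mathcal{H}_\pi)[\mathsf{t}_{s^*}]$; (c) the set $\mathfrak{A}_{\rm b}^{\mathcal{M}}$ of $\mathcal{M}$-bounded elements is a C*-algebra with respect to the norm $\|\cdot\|^{\mathcal{M}}_{\rm b}$.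
   Context: Vector spaces are complex; sesquilinear forms and inner products are linear in the first variable. Quasi *-algebra. A quasi *-algebra $(\mathfrak{A},\mathfrak{A}_0)$ is a vector space $\mathfrak{A}$ with a *-algebra $\mathfrak{A}_0$ contained in $\mathfrak{A}$ as a subspace, such that: (i) $\mathfrak{A}$ carries an involution $a\mapsto a^*$ extending that of $\mathfrak{A}_0$; (ii) $\mathfrak{A}$ is a bimodule over $\mathfrak{A}_0$, with module multiplications extending the multiplication of $\mathfrak{A}_0$; in particular $(xa)y=x(ay)$ and $a(xy)=(ax)y$ for $a\in\mathfrak{A}$, $x,y\in\mathfrak{A}_0$; (iii) $(ax)^*=x^*a^*$ for $a\in\mathfrak{A}$, $x\in\mathfrak{A}_0$. A unit is an element $\mathsf{e}\in\mathfrak{A}_0$ with $a\mathsf{e}=\mathsf{e}a=a$ for all $a\in\mathfrak{A}$. Locally convex quasi *-algebra. $(\mathfrak{A}[\tau],\mathfrak{A}_0)$ is a locally convex quasi *-algebra if $\tau$ is a locally convex topology on $\mathfrak{A}$ such that $x\mapsto x^*$ is continuous on $\mathfrak{A}_0$; for every $a\in\mathfrak{A}$ the maps $x\mapsto ax$, $x\mapsto xa$ from $\mathfrak{A}_0$ into $\mathfrak{A}$ are continuous; and $\mathfrak{A}_0$ is $\tau$-dense in $\mathfrak{A}$. Forms. $\mathcal{Q}_{\mathfrak{A}_0}(\mathfrak{A})$ is the set of sesquilinear forms $\varphi$ on $\mathfrak{A}\times\mathfrak{A}$ with $\varphi(a,a)\ge0$ for $a\in\mathfrak{A}$ and $\varphi(ax,y)=\varphi(x,a^*y)$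 for $a\in\mathfrak{A}$, $x,y\in\mathfrak{A}_0$. For such $\varphi$, $N_\varphi=\{a:\varphi(a,a)=0\}$, $\lambda_\varphi:\mathfrak{A}\to\mathfrak{A}/N_\varphi$ is the quotient map, and $\mathcal{H}_\varphi$ is the Hilbert space completion of $\lambda_\varphi(\mathfrak{A})$ for $\langle\lambda_\varphi(a)|\lambda_\varphi(b)\rangle=\varphi(a,b)$. $\mathcal{I}_{\mathfrak{A}_0}(\mathfrak{A})$ is the set of $\varphi\in\mathcal{Q}_{\mathfrak{A}_0}(\mathfrak{A})$ with $\lambda_\varphi(\mathfrak{A}_0)$ dense in $\mathcal{H}_\varphi$. For $x\in\mathfrak{A}_0$, $\varphi^x(a,b):=\varphi(ax,bx)$. A set $\mathcal{M}\subset\mathcal{I}_{\mathfrak{A}_0}(\mathfrak{A})$ is balanced if $\varphi\in\mathcal{M}$, $x\in\mathfrak{A}_0$ imply $\varphi^x\in\mathcal{M}$; it is sufficient if it is balanced and for every $a\in\mathfrak{A}\setminus\{0\}$ there is $\varphi\in\mathcal{M}$ with $\varphi(a,a)>0$. Operators. For a dense subspace $\mathcal{D}$ of a Hilbert space $\mathcal{H}$, $\mathcal{L}^\dagger(\mathcal{D},\mathcal{H})$ is the set of closable operators $X$ in $\mathcal{H}$ with domain $D(X)=\mathcal{D}$ and $D(X^* )\supset\mathcal{D}$; $X^\dagger:=X^*\upharpoonright\mathcal{D}$. The weak product $X_1\,\square\,X_2:=(X_1^\dagger)^*X_2$ is defined when $X_2\mathcal{D}\subset D((X_1^\dagger)^*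 )$ and $X_1^*\mathcal{D}\subset D(X_2^* )$. The strong* topology $\mathsf{t}_{s^*}$ on $\mathcal{L}^\dagger(\mathcal{D},\mathcal{H})$ is defined by the seminorms $X\mapsto\max\{\|X\xi\|,\|X^\dagger\xi\|\}$, $\xi\in\mathcal{D}$. Representations. A *-representation $\pi$ of $(\mathfrak{A},\mathfrak{A}_0)$ is a linear map $\pi:\mathfrak{A}\to\mathcal{L}^\dagger(\mathcal{D}_\pi,\mathcal{H}_\pi)$, $\mathcal{D}_\pi$ a dense subspace of a Hilbert space $\mathcal{H}_\pi$, with $\pi(a^* )=\pi(a)^\dagger$ for $a\in\mathfrak{A}$, and, for $a\in\mathfrak{A}$, $x\in\mathfrak{A}_0$, $\pi(a)\,\square\,\pi(x)$ well-defined and equal to $\pi(ax)$; if there is a unit, $\pi(\mathsf{e})$ is the identity of $\mathcal{D}_\pi$. $\pi$ is $\mathcal{M}$-regular if for every $\xi\in\mathcal{D}_\pi$ the form $\varphi_\xi(a,b)=\langle\pi(a)\xi|\pi(b)\xi\rangle$ belongs to $\mathcal{M}$. For $\varphi\in\mathcal{I}_{\mathfrak{A}_0}(\mathfrak{A})$, $\pi^\circ_\varphi$ is the *-representation on $\lambda_\varphi(\mathfrak{A}_0)$ given by $\pi^\circ_\varphi(a)\lambda_\varphi(x)=\lambda_\varphi(ax)$, and the GNS representation $\pi_\varphi$ is its closure: $\mathcal{D}_\varphi$ is the completion (inside $\mathcal{H}_\varphi$) of $\lambda_\varphi(\mathfrak{A}_0)$ in the graph topology given by the norm and the seminorms $\xi\mapsto\|\pi^\circ_\varphi(a)\xi\|$,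 $a\in\mathfrak{A}$, and $\pi_\varphi(a)$ is the restriction to $\mathcal{D}_\varphi$ of the closure of $\pi^\circ_\varphi(a)$. Bounded elements. Let $\mathcal{M}$ be sufficient. $a\in\mathfrak{A}$ is $\mathcal{M}$-bounded if there is $\gamma_a>0$ with $|\varphi(ax,y)|\le\gamma_a\varphi(x,x)^{1/2}\varphi(y,y)^{1/2}$ for all $\varphi\in\mathcal{M}$, $x,y\in\mathfrak{A}_0$; $\|a\|^{\mathcal{M}}_{\rm b}$ is the infimum of such $\gamma_a$; $\mathfrak{A}^{\mathcal{M}}_{\rm b}$ is the set of $\mathcal{M}$-bounded elements. The weak multiplication on $\mathfrak{A}$ (relative to $\mathcal{M}$): $a\diamond b$ is well-defined if there is $c\in\mathfrak{A}$ (then unique) with $\varphi(bx,a^*y)=\varphi(cx,y)$ for all $x,y\in\mathfrak{A}_0$, $\varphi\in\mathcal{M}$, and $a\diamond b:=c$. The algebra structure on $\mathfrak{A}^{\mathcal{M}}_{\rm b}$ is given by $\diamond$ and the involution of $\mathfrak{A}$. Condition (C): if $a,b\in\mathfrak{A}^{\mathcal{M}}_{\rm b}$, there is a unique $c\in\mathfrak{A}$ such that $\pi_\varphi(a)\,\square\,\pi_\varphi(b)=\pi_\varphi(c)$ for every $\varphi\in\mathcal{M}$. Topology $\tau^{\mathfrak{F}}_*$. A subset $\mathcal{F}\subset\mathcal{M}$ is bounded if $\sup_{\varphi\in\mathcal{F}}\varphi(a,a)<\infty$ for all $a\in\mathfrak{A}$; $\mathfrak{F}$ is the family of bounded subsets.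 Put $p^{\mathcal{F}}(a)=\sup_{\varphi\in\mathcal{F}}\varphi(a,a)^{1/2}$ and $p^{\mathcal{F}}_*(a)=\max\{p^{\mathcal{F}}(a),p^{\mathcal{F}}(a^* )\}$. $\tau^{\mathfrak{F}}_*$ is the locally convex topology defined by the seminorms $p^{\mathcal{F}}_*$, $\mathcal{F}\in\mathfrak{F}$. $\mathcal{M}\subset\mathcal{I}_{\mathfrak{A}_0}(\mathfrak{A})$ is strongly well-behaved if: $\mathcal{M}$ is sufficient; every $x\in\mathfrak{A}_0$ is $\mathcal{M}$-bounded; condition (C) holds; $\mathfrak{A}$ is $\tau^{\mathfrak{F}}_*$-complete. A locally convex quasi *-algebra $(\mathfrak{A}[\tau],\mathfrak{A}_0)$ is a locally convex quasi GA*-algebra if there is a strongly well-behaved $\mathcal{M}\subset\mathcal{I}_{\mathfrak{A}_0}(\mathfrak{A})$ such that $\tau$ and $\tau^{\mathfrak{F}}_*$ are equivalent (define the same topology). *)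

theory Defs
  imports "HOL-Analysis.Analysis" "HOL-Library.Function_Algebras"
begin

section \<open>Topologies given by seminorms\<close>

text \<open>
  The difference operation is a parameter because these notions are used both for vectors and for
  unbounded operators with a common domain.  The carrier \<open>V\<close> is inserted among the generators
  so that the empty family yields the indiscrete topology on \<open>V\<close>.
\<close>

definition seminorm_topology :: "'v set \<Rightarrow> ('v \<Rightarrow> 'v \<Rightarrow> 'v) \<Rightarrow> ('v \<Rightarrow> real) set \<Rightarrow> 'v topology" where
  "seminorm_topology V diff P =
     topology_generated_by (insert V {{y \<in> V. p (diff y x) < r} | p x r. p \<in> P \<and> x \<in> V \<and> 0 < r})"

definition seminorm_cauchy ::
    "'v set \<Rightarrow> ('v \<Rightarrow> 'v \<Rightarrow> 'v) \<Rightarrow> ('v \<Rightarrow> real) set \<Rightarrow> 'v filter \<Rightarrow> bool" where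
  "seminorm_cauchy V diff P F \<longleftrightarrow>
     F \<noteq> bot \<and> eventually (\<lambda>x. x \<in> V) F \<and>
     (\<forall>p\<in>P. \<forall>r>0. \<exists>S\<subseteq>V. eventually (\<lambda>x. x \<in> S) F \<and> (\<forall>x\<in>S. \<forall>y\<in>S. p (diff y x) < r))"

definition seminorm_complete :: "'v set \<Rightarrow> ('v \<Rightarrow> 'v \<Rightarrow> 'v) \<Rightarrow> ('v \<Rightarrow> real) set \<Rightarrow> bool" where
  "seminorm_complete V diff P \<longleftrightarrow>
     (\<forall>F. seminorm_cauchy V diff P F \<longrightarrow>
        (\<exists>x. limitin (seminorm_topology V diff P) (\<lambda>y. y) x F))"

definition seminorm_on :: "(complex \<Rightarrow> 'v::ab_group_add \<Rightarrow> 'v) \<Rightarrow> ('v \<Rightarrow> real) \<Rightarrow> bool" where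
  "seminorm_on sc p \<longleftrightarrow>
     (\<forall>a. 0 \<le> p a) \<and> (\<forall>a b. p (a + b) \<le> p a + p b) \<and> (\<forall>c a. p (sc c a) = cmod c * p a)"

definition locally_convex :: "(complex \<Rightarrow> 'v::ab_group_add \<Rightarrow> 'v) \<Rightarrow> 'v topology \<Rightarrow> bool" where
  "locally_convex sc \<tau> \<longleftrightarrow> (\<exists>P. (\<forall>p\<in>P. seminorm_on sc p) \<and> \<tau> = seminorm_topology UNIV (-) P)"


section \<open>Quasi *-algebras\<close>

text \<open>
  The vector space is the whole type.  The field \<open>qmul\<close> is a total function, but it
  is constrained and used only when at least one of the two factors lies in \<open>qcore\<close>.
\<close>

record 'a quasi =
  qscale :: "complex \<Rightarrow> 'a \<Rightarrow> 'a"
  qcore :: "'a set"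
  qmul :: "'a \<Rightarrow> 'a \<Rightarrow> 'a"
  qstar :: "'a \<Rightarrow> 'a"

locale quasi_star_algebra =
  fixes Q :: "'a::ab_group_add quasi"
  assumes vs: "vector_space (qscale Q)"
    and core_subspace: "module.subspace (qscale Q) (qcore Q)"
    and core_mul: "\<lbrakk>x \<in> qcore Q; y \<in> qcore Q\<rbrakk> \<Longrightarrow> qmul Q x y \<in> qcore Q"
    and core_star: "x \<in> qcore Q \<Longrightarrow> qstar Q x \<in> qcore Q"
    and star_star: "qstar Q (qstar Q a) = a"
    and star_add: "qstar Q (a + b) = qstar Q a + qstar Q b"
    and star_scale: "qstar Q (qscale Q c a) = qscale Q (cnj c) (qstar Q a)"
    and star_mul: "x \<in> qcore Q \<Longrightarrow> qstar Q (qmul Q a x) = qmul Q (qstar Q x) (qstar Q a)"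
    and right_linear: "x \<in> qcore Q \<Longrightarrow> Vector_Spaces.linear (qscale Q) (qscale Q) (\<lambda>a. qmul Q a x)"
    and left_linear: "x \<in> qcore Q \<Longrightarrow> Vector_Spaces.linear (qscale Q) (qscale Q) (\<lambda>a. qmul Q x a)"
    and right_add: "\<lbrakk>x \<in> qcore Q; y \<in> qcore Q\<rbrakk> \<Longrightarrow> qmul Q a (x + y) = qmul Q a x + qmul Q a y"
    and right_scale: "x \<in> qcore Q \<Longrightarrow> qmul Q a (qscale Q c x) = qscale Q c (qmul Q a x)"
    and left_add: "\<lbrakk>x \<in> qcore Q; y \<in> qcore Q\<rbrakk> \<Longrightarrow> qmul Q (x + y) a = qmul Q x a + qmul Q y a"
    and left_scale: "x \<in> qcore Q \<Longrightarrow> qmul Q (qscale Q c x) a = qscale Q c (qmul Q x a)"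
    and assoc_left: "\<lbrakk>x \<in> qcore Q; y \<in> qcore Q\<rbrakk> \<Longrightarrow> qmul Q (qmul Q x y) a = qmul Q x (qmul Q y a)"
    and assoc_mid: "\<lbrakk>x \<in> qcore Q; y \<in> qcore Q\<rbrakk> \<Longrightarrow> qmul Q (qmul Q x a) y = qmul Q x (qmul Q a y)"
    and assoc_right: "\<lbrakk>x \<in> qcore Q; y \<in> qcore Q\<rbrakk> \<Longrightarrow> qmul Q (qmul Q a x) y = qmul Q a (qmul Q x y)"

definition quasi_unit :: "'a quasi \<Rightarrow> 'a \<Rightarrow> bool" where
  "quasi_unit Q e \<longleftrightarrow> e \<in> qcore Q \<and> (\<forall>a. qmul Q a e = a \<and> qmul Q e a = a)"

definition lc_quasi_star_algebra :: "'a::ab_group_add quasi \<Rightarrow> 'a topology \<Rightarrow> bool" where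
  "lc_quasi_star_algebra Q \<tau> \<longleftrightarrow>
     quasi_star_algebra Q \<and> locally_convex (qscale Q) \<tau> \<and>
     continuous_map (subtopology \<tau> (qcore Q)) (subtopology \<tau> (qcore Q)) (qstar Q) \<and>
     (\<forall>a. continuous_map (subtopology \<tau> (qcore Q)) \<tau> (\<lambda>x. qmul Q a x)) \<and>
     (\<forall>a. continuous_map (subtopology \<tau> (qcore Q)) \<tau> (\<lambda>x. qmul Q x a)) \<and>
     \<tau> closure_of (qcore Q) = UNIV"


section \<open>Sesquilinear forms\<close>

type_synonym 'a form = "'a \<Rightarrow> 'a \<Rightarrow> complex"

definition sesquilinear :: "(complex \<Rightarrow> 'a::ab_group_add \<Rightarrow> 'a) \<Rightarrow> 'a form \<Rightarrow> bool" where
  "sesquilinear sc \<phi> \<longleftrightarrow>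
     (\<forall>a b d. \<phi> (a + b) d = \<phi> a d + \<phi> b d) \<and> (\<forall>c a d. \<phi> (sc c a) d = c * \<phi> a d) \<and>
     (\<forall>a b d. \<phi> a (b + d) = \<phi> a b + \<phi> a d) \<and> (\<forall>c a d. \<phi> a (sc c d) = cnj c * \<phi> a d)"

definition positive_form :: "'a form \<Rightarrow> bool" where
  "positive_form \<phi> \<longleftrightarrow> (\<forall>a. \<phi> a a \<in> \<real> \<and> 0 \<le> Re (\<phi> a a))"

definition form_norm :: "'a form \<Rightarrow> 'a \<Rightarrow> real" where
  "form_norm \<phi> a = sqrt (Re (\<phi> a a))"

lemma sesqD:
  assumes "vector_space sc" "sesquilinear sc \<phi>"
  shows "\<phi> (a + b) d = \<phi> a d + \<phi> b d" "\<phi> (sc c a) d = c * \<phi> a d"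
    "\<phi> a (b + d) = \<phi> a b + \<phi> a d" "\<phi> a (sc c d) = cnj c * \<phi> a d"
    "\<phi> 0 d = 0" "\<phi> a 0 = 0" "\<phi> (a - b) d = \<phi> a d - \<phi> b d" "\<phi> a (b - d) = \<phi> a b - \<phi> a d"
proof -
  show *: "\<phi> (a + b) d = \<phi> a d + \<phi> b d" "\<phi> a (b + d) = \<phi> a b + \<phi> a d" for a b d
    using assms(2) by (auto simp: sesquilinear_def)
  show "\<phi> (sc c a) d = c * \<phi> a d" "\<phi> a (sc c d) = cnj c * \<phi> a d"
    using assms(2) by (auto simp: sesquilinear_def)
  show "\<phi> 0 d = 0" "\<phi> a 0 = 0"
    using *(1)[of 0 0 d] *(2)[of a 0 0] by auto
  show "\<phi> (a - b) d = \<phi> a d - \<phi> b d" "\<phi> a (b - d) = \<phi> a b - \<phi> a d"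
    using *(1)[of "a - b" b d] *(2)[of a "b - d" d] by auto
qed

text \<open>
  Hermitian symmetry and the Cauchy-Schwarz inequality, stated relative to a set closed under the
  vector operations so that they apply to semidefinite forms as well as to Hilbert spaces.
\<close>

lemma semidefinite_cauchy_schwarz:
  fixes \<phi> :: "'v::ab_group_add form"
  assumes add: "\<And>a b. a \<in> V \<Longrightarrow> b \<in> V \<Longrightarrow> a + b \<in> V" and scl: "\<And>c a. a \<in> V \<Longrightarrow> sc c a \<in> V"
    and l1: "\<And>a b d. a \<in> V \<Longrightarrow> b \<in> V \<Longrightarrow> d \<in> V \<Longrightarrow> \<phi> (a + b) d = \<phi> a d + \<phi> b d"
    and l2: "\<And>c a d. a \<in> V \<Longrightarrow> d \<in> V \<Longrightarrow> \<phi> (sc c a) d = c * \<phi> a d"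
    and herm: "\<And>a b. a \<in> V \<Longrightarrow> b \<in> V \<Longrightarrow> \<phi> b a = cnj (\<phi> a b)"
    and pos: "\<And>a. a \<in> V \<Longrightarrow> 0 \<le> Re (\<phi> a a)"
    and V: "a \<in> V" "b \<in> V"
  shows "cmod (\<phi> a b) \<le> form_norm \<phi> a * form_norm \<phi> b"
proof -
  have real: "\<phi> d d = of_real (Re (\<phi> d d))" if "d \<in> V" for d
    using herm[OF that that] by (simp add: complex_eq_iff)
  define A B C where "A = Re (\<phi> a a)" and "B = Re (\<phi> b b)" and "C = \<phi> a b"
  have AB: "0 \<le> A" "0 \<le> B" using pos V by (auto simp: A_def B_def)
  have exp: "0 \<le> A * (cmod s)\<^sup>2 + 2 * Re (s * C * cnj t) + B * (cmod t)\<^sup>2" for s t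
  proof -
    let ?v = "sc s a + sc t b"
    have "\<phi> x (sc c y) = cnj c * \<phi> x y" if "x \<in> V" "y \<in> V" for x y c
      using that by (metis complex_cnj_mult herm l2 scl)
    moreover have "\<phi> x (y + z) = \<phi> x y + \<phi> x z" if "x \<in> V" "y \<in> V" "z \<in> V" for x y z
      using that by (metis complex_cnj_add herm l1 add)
    ultimately have "\<phi> ?v ?v = s * cnj s * \<phi> a a + s * cnj t * \<phi> a b + t * cnj s * \<phi> b a + t * cnj t * \<phi> b b"
      using V by (simp add: add scl l1 l2 algebra_simps)
    also have "\<dots> = of_real (A * (cmod s)\<^sup>2 + B * (cmod t)\<^sup>2) + (s * C * cnj t + cnj (s * C * cnj t))"
      using real[OF V(1)] real[OF V(2)] herm[OF V]
      by (simp add: A_def B_def C_def complex_norm_square algebra_simps del: of_real_power)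
    finally have "Re (\<phi> ?v ?v) = A * (cmod s)\<^sup>2 + B * (cmod t)\<^sup>2 + 2 * Re (s * C * cnj t)"
      by (simp add: algebra_simps)
    then show ?thesis using pos[of ?v] V add scl by simp
  qed
  have "(cmod C)\<^sup>2 \<le> A * B"
  proof (cases "A = 0")
    case True
    show ?thesis
    proof (cases "C = 0")
      case False
      have "0 \<le> 2 * Re (of_real (-(B + 1) / (cmod C)\<^sup>2) * cnj C * C * cnj 1) + B"
        using exp[of "of_real (-(B + 1) / (cmod C)\<^sup>2) * cnj C" 1] True by simp
      also have "of_real (-(B + 1) / (cmod C)\<^sup>2) * cnj C * C * cnj 1 = complex_of_real (-(B + 1))"
        using False complex_norm_square[of C] by (simp add: field_simps)
      finally have "0 \<le> 2 * (-(B + 1)) + B" by simp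
      then show ?thesis using AB by simp
    qed (use AB in simp)
  next
    case False
    then have A: "0 < A" using AB by simp
    have "0 \<le> A * (cmod C)\<^sup>2 + 2 * Re (- cnj C * C * cnj (of_real A)) + B * A\<^sup>2"
      using exp[of "- cnj C" "of_real A"] AB by simp
    also have "- cnj C * C * cnj (of_real A) = complex_of_real (- ((cmod C)\<^sup>2 * A))"
      using complex_norm_square[of C] by (simp add: mult.commute)
    finally have "0 \<le> A * (A * B - (cmod C)\<^sup>2)" by (simp add: algebra_simps power2_eq_square)
    then show ?thesis using A by (simp add: zero_le_mult_iff)
  qed
  then have "sqrt ((cmod C)\<^sup>2) \<le> sqrt (A * B)" by (rule real_sqrt_le_mono)
  then show ?thesis by (simp add: form_norm_def real_sqrt_mult A_def B_def C_def)
qed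

lemma semidefinite_triangle:
  fixes \<phi> :: "'v::ab_group_add form"
  assumes add: "\<And>a b. a \<in> V \<Longrightarrow> b \<in> V \<Longrightarrow> a + b \<in> V" and scl: "\<And>c a. a \<in> V \<Longrightarrow> sc c a \<in> V"
    and l1: "\<And>a b d. a \<in> V \<Longrightarrow> b \<in> V \<Longrightarrow> d \<in> V \<Longrightarrow> \<phi> (a + b) d = \<phi> a d + \<phi> b d"
    and l2: "\<And>c a d. a \<in> V \<Longrightarrow> d \<in> V \<Longrightarrow> \<phi> (sc c a) d = c * \<phi> a d"
    and herm: "\<And>a b. a \<in> V \<Longrightarrow> b \<in> V \<Longrightarrow> \<phi> b a = cnj (\<phi> a b)"
    and pos: "\<And>a. a \<in> V \<Longrightarrow> 0 \<le> Re (\<phi> a a)"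
    and V: "a \<in> V" "b \<in> V"
  shows "form_norm \<phi> (a + b) \<le> form_norm \<phi> a + form_norm \<phi> b"
proof -
  have "\<phi> x (y + z) = \<phi> x y + \<phi> x z" if "x \<in> V" "y \<in> V" "z \<in> V" for x y z
    using that by (metis complex_cnj_add herm l1 add)
  then have "\<phi> (a + b) (a + b) = \<phi> a a + (\<phi> a b + cnj (\<phi> a b)) + \<phi> b b"
    using V herm[OF V] by (simp add: l1 add)
  then have "Re (\<phi> (a + b) (a + b)) = Re (\<phi> a a) + 2 * Re (\<phi> a b) + Re (\<phi> b b)"
    by (simp add: complex_add_cnj)
  also have "\<dots> \<le> (form_norm \<phi> a)\<^sup>2 + 2 * (form_norm \<phi> a * form_norm \<phi> b) + (form_norm \<phi> b)\<^sup>2"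
    using semidefinite_cauchy_schwarz[OF assms] complex_Re_le_cmod[of "\<phi> a b"] pos V
    by (simp add: form_norm_def)
  also have "\<dots> = (form_norm \<phi> a + form_norm \<phi> b)\<^sup>2" by (simp add: power2_sum)
  finally show ?thesis
    using pos V by (auto simp: form_norm_def intro!: real_le_lsqrt)
qed


section \<open>Hilbert spaces\<close>

text \<open>
  A Hilbert space is a linear subspace of a complex vector space, with an inner product that is
  constrained on this subspace only.  The carrier is needed because the Hilbert space attached to
  a form depends on the form and cannot be a type of its own.
\<close>

record 'h hspace =
  hcarrier :: "'h set"
  hscale :: "complex \<Rightarrow> 'h \<Rightarrow> 'h"
  hinner :: "'h \<Rightarrow> 'h \<Rightarrow> complex"

definition hnorm :: "'h hspace \<Rightarrow> 'h \<Rightarrow> real" where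
  "hnorm H = form_norm (hinner H)"

text \<open>
  The locale \<open>Metric_space\<close> requires non-negativity and symmetry on the whole type; hence the
  default value outside the carrier.
\<close>

definition norm_dist :: "'v::ab_group_add set \<Rightarrow> ('v \<Rightarrow> real) \<Rightarrow> 'v \<Rightarrow> 'v \<Rightarrow> real" where
  "norm_dist V nrm x y = (if x \<in> V \<and> y \<in> V then nrm (x - y) else 0)"

definition hdist :: "'h::ab_group_add hspace \<Rightarrow> 'h \<Rightarrow> 'h \<Rightarrow> real" where
  "hdist H = norm_dist (hcarrier H) (hnorm H)"

definition htop :: "'h::ab_group_add hspace \<Rightarrow> 'h topology" where
  "htop H = Metric_space.mtopology (hcarrier H) (hdist H)"

locale inner_product_space =
  fixes H :: "'h::ab_group_add hspace"
  assumes vs: "vector_space (hscale H)"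
    and carrier_subspace: "module.subspace (hscale H) (hcarrier H)"
    and inner_add: "\<lbrakk>\<xi> \<in> hcarrier H; \<eta> \<in> hcarrier H; \<zeta> \<in> hcarrier H\<rbrakk> \<Longrightarrow>
                      hinner H (\<xi> + \<eta>) \<zeta> = hinner H \<xi> \<zeta> + hinner H \<eta> \<zeta>"
    and inner_scale: "\<lbrakk>\<xi> \<in> hcarrier H; \<eta> \<in> hcarrier H\<rbrakk> \<Longrightarrow>
                      hinner H (hscale H c \<xi>) \<eta> = c * hinner H \<xi> \<eta>"
    and inner_cnj: "\<lbrakk>\<xi> \<in> hcarrier H; \<eta> \<in> hcarrier H\<rbrakk> \<Longrightarrow> hinner H \<eta> \<xi> = cnj (hinner H \<xi> \<eta>)"
    and inner_pos: "\<lbrakk>\<xi> \<in> hcarrier H; \<xi> \<noteq> 0\<rbrakk> \<Longrightarrow> 0 < Re (hinner H \<xi> \<xi>)"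

locale hilbert_space = inner_product_space +
  assumes complete: "Metric_space.mcomplete (hcarrier H) (hdist H)"

context inner_product_space
begin

lemma carrier_add: "\<xi> \<in> hcarrier H \<Longrightarrow> \<eta> \<in> hcarrier H \<Longrightarrow> \<xi> + \<eta> \<in> hcarrier H"
  and carrier_scale: "\<xi> \<in> hcarrier H \<Longrightarrow> hscale H c \<xi> \<in> hcarrier H"
  and carrier_diff: "\<xi> \<in> hcarrier H \<Longrightarrow> \<eta> \<in> hcarrier H \<Longrightarrow> \<xi> - \<eta> \<in> hcarrier H"
  and carrier_0: "0 \<in> hcarrier H"
proof -
  interpret V: vector_space "hscale H" by (rule vs)
  show "\<xi> \<in> hcarrier H \<Longrightarrow> \<eta> \<in> hcarrier H \<Longrightarrow> \<xi> + \<eta> \<in> hcarrier H"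
    "\<xi> \<in> hcarrier H \<Longrightarrow> hscale H c \<xi> \<in> hcarrier H"
    "\<xi> \<in> hcarrier H \<Longrightarrow> \<eta> \<in> hcarrier H \<Longrightarrow> \<xi> - \<eta> \<in> hcarrier H"
    "0 \<in> hcarrier H"
    using V.subspace_add V.subspace_scale V.subspace_diff V.subspace_0 carrier_subspace by blast+
qed

lemma inner_zero: "hinner H 0 \<zeta> = 0" if "\<zeta> \<in> hcarrier H"
  using inner_add[OF carrier_0 carrier_0 that] by simp

lemma inner_nonneg: "\<xi> \<in> hcarrier H \<Longrightarrow> 0 \<le> Re (hinner H \<xi> \<xi>)"
  using inner_pos[of \<xi>] inner_zero[OF carrier_0] by (cases "\<xi> = 0") auto

lemma inner_cauchy_schwarz:
  "\<xi> \<in> hcarrier H \<Longrightarrow> \<eta> \<in> hcarrier H \<Longrightarrow> cmod (hinner H \<xi> \<eta>) \<le> hnorm H \<xi> * hnorm H \<eta>"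
  unfolding hnorm_def
  by (rule semidefinite_cauchy_schwarz[where V = "hcarrier H" and sc = "hscale H"])
     (auto simp: carrier_add carrier_scale inner_add inner_scale inner_nonneg intro: inner_cnj)

lemma hnorm_triangle:
  "\<xi> \<in> hcarrier H \<Longrightarrow> \<eta> \<in> hcarrier H \<Longrightarrow> hnorm H (\<xi> + \<eta>) \<le> hnorm H \<xi> + hnorm H \<eta>"
  unfolding hnorm_def
  by (rule semidefinite_triangle[where V = "hcarrier H" and sc = "hscale H"])
     (auto simp: carrier_add carrier_scale inner_add inner_scale inner_nonneg intro: inner_cnj)

lemma hnorm_nonneg: "\<xi> \<in> hcarrier H \<Longrightarrow> 0 \<le> hnorm H \<xi>"
  by (simp add: hnorm_def form_norm_def inner_nonneg)

lemma hnorm_eq_0_iff: "\<xi> \<in> hcarrier H \<Longrightarrow> hnorm H \<xi> = 0 \<longleftrightarrow> \<xi> = 0"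
  using inner_pos[of \<xi>] inner_zero[OF carrier_0] by (cases "\<xi> = 0") (auto simp: hnorm_def form_norm_def)

lemma hnorm_scale:
  assumes "\<xi> \<in> hcarrier H"
  shows "hnorm H (hscale H c \<xi>) = cmod c * hnorm H \<xi>"
proof -
  have "hinner H \<xi> (hscale H c \<xi>) = cnj c * hinner H \<xi> \<xi>"
    using assms inner_cnj[of "hscale H c \<xi>" \<xi>] inner_cnj[of \<xi> \<xi>]
    by (metis carrier_scale complex_cnj_mult inner_scale)
  then have "hinner H (hscale H c \<xi>) (hscale H c \<xi>) = of_real ((cmod c)\<^sup>2) * hinner H \<xi> \<xi>"
    using assms carrier_scale[OF assms, of c] by (simp add: inner_scale complex_norm_square del: of_real_power)
  then show ?thesis by (simp add: hnorm_def form_norm_def real_sqrt_mult)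
qed

lemma Metric_space_hdist: "Metric_space (hcarrier H) (hdist H)"
proof
  interpret V: vector_space "hscale H" by (rule vs)
  show "0 \<le> hdist H x y" for x y
    by (simp add: hdist_def norm_dist_def hnorm_nonneg carrier_diff)
  show "hdist H x y = hdist H y x" for x y
    using hnorm_scale[OF carrier_diff, of x y "-1"] by (simp add: hdist_def norm_dist_def)
  show "hdist H x y = 0 \<longleftrightarrow> x = y" if "x \<in> hcarrier H" "y \<in> hcarrier H" for x y
    using that by (simp add: hdist_def norm_dist_def hnorm_eq_0_iff carrier_diff)
  show "hdist H x z \<le> hdist H x y + hdist H y z"
    if "x \<in> hcarrier H" "y \<in> hcarrier H" "z \<in> hcarrier H" for x y z
    using that hnorm_triangle[of "x - y" "y - z"] by (simp add: hdist_def norm_dist_def carrier_diff)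
qed

end

definition dense_subspace :: "'h::ab_group_add hspace \<Rightarrow> 'h set \<Rightarrow> bool" where
  "dense_subspace H D \<longleftrightarrow>
     module.subspace (hscale H) D \<and> D \<subseteq> hcarrier H \<and> htop H closure_of D = hcarrier H"


section \<open>Unbounded operators\<close>

text \<open>
  An operator in a Hilbert space is identified with its graph, so that \<open>Domain X\<close> is its domain,
  equality of operators includes equality of domains, \<open>X O Y\<close> is the operator product
  "first \<open>X\<close>, then \<open>Y\<close>", and \<open>X `` S\<close> is the image of \<open>S\<close>.
\<close>

type_synonym 'h operator = "('h \<times> 'h) set"

definition op_val :: "'h operator \<Rightarrow> 'h \<Rightarrow> 'h" where
  "op_val X \<xi> = (THE \<eta>. (\<xi>, \<eta>) \<in> X)"

definition op_add :: "'h::ab_group_add operator \<Rightarrow> 'h operator \<Rightarrow> 'h operator" where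
  "op_add X Y = {(\<xi>, \<eta> + \<zeta>) | \<xi> \<eta> \<zeta>. (\<xi>, \<eta>) \<in> X \<and> (\<xi>, \<zeta>) \<in> Y}"

definition op_scale :: "'h hspace \<Rightarrow> complex \<Rightarrow> 'h operator \<Rightarrow> 'h operator" where
  "op_scale H c X = {(\<xi>, hscale H c \<eta>) | \<xi> \<eta>. (\<xi>, \<eta>) \<in> X}"

definition op_diff :: "'h::ab_group_add hspace \<Rightarrow> 'h operator \<Rightarrow> 'h operator \<Rightarrow> 'h operator" where
  "op_diff H X Y = op_add X (op_scale H (-1) Y)"

definition op_closure :: "'h::ab_group_add hspace \<Rightarrow> 'h operator \<Rightarrow> 'h operator" where
  "op_closure H X = prod_topology (htop H) (htop H) closure_of X"

definition closable_op :: "'h::ab_group_add hspace \<Rightarrow> 'h operator \<Rightarrow> bool" where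
  "closable_op H X \<longleftrightarrow> single_valued (op_closure H X)"

definition linear_op :: "'h::ab_group_add hspace \<Rightarrow> 'h operator \<Rightarrow> bool" where
  "linear_op H X \<longleftrightarrow>
     X \<subseteq> hcarrier H \<times> hcarrier H \<and> single_valued X \<and>
     (\<forall>\<xi> \<eta> \<xi>' \<eta>'. (\<xi>, \<eta>) \<in> X \<longrightarrow> (\<xi>', \<eta>') \<in> X \<longrightarrow> (\<xi> + \<xi>', \<eta> + \<eta>') \<in> X) \<and>
     (\<forall>c \<xi> \<eta>. (\<xi>, \<eta>) \<in> X \<longrightarrow> (hscale H c \<xi>, hscale H c \<eta>) \<in> X)"

definition op_adj :: "'h hspace \<Rightarrow> 'h operator \<Rightarrow> 'h operator" where
  "op_adj H X = {(\<eta>, \<zeta>). \<eta> \<in> hcarrier H \<and> \<zeta> \<in> hcarrier H \<and>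
                        (\<forall>(\<xi>, \<xi>') \<in> X. hinner H \<xi>' \<eta> = hinner H \<xi> \<zeta>)}"

definition op_dag :: "'h hspace \<Rightarrow> 'h operator \<Rightarrow> 'h operator" where
  "op_dag H X = {(\<eta>, \<zeta>) \<in> op_adj H X. \<eta> \<in> Domain X}"

definition Ldag :: "'h::ab_group_add hspace \<Rightarrow> 'h set \<Rightarrow> 'h operator set" where
  "Ldag H D = {X. linear_op H X \<and> closable_op H X \<and> Domain X = D \<and> D \<subseteq> Domain (op_adj H X)}"

definition weak_prod_defined :: "'h hspace \<Rightarrow> 'h set \<Rightarrow> 'h operator \<Rightarrow> 'h operator \<Rightarrow> bool" where
  "weak_prod_defined H D X Y \<longleftrightarrow>
     Y `` D \<subseteq> Domain (op_adj H (op_dag H X)) \<and> op_adj H X `` D \<subseteq> Domain (op_adj H Y)"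

definition weak_prod :: "'h hspace \<Rightarrow> 'h operator \<Rightarrow> 'h operator \<Rightarrow> 'h operator" where
  "weak_prod H X Y = Y O op_adj H (op_dag H X)"

definition strong_star_topology :: "'h::ab_group_add hspace \<Rightarrow> 'h set \<Rightarrow> 'h operator topology" where
  "strong_star_topology H D =
     seminorm_topology (Ldag H D) (op_diff H)
       {\<lambda>X. max (hnorm H (op_val X \<xi>)) (hnorm H (op_val (op_dag H X) \<xi>)) | \<xi>. \<xi> \<in> D}"


section \<open>Representations\<close>

definition star_rep ::
    "'a::ab_group_add quasi \<Rightarrow> 'h::ab_group_add hspace \<Rightarrow> 'h set \<Rightarrow> ('a \<Rightarrow> 'h operator) \<Rightarrow> bool" where
  "star_rep Q H D \<pi> \<longleftrightarrow>
     hilbert_space H \<and> dense_subspace H D \<and>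
     (\<forall>a. \<pi> a \<in> Ldag H D) \<and>
     (\<forall>a b. \<pi> (a + b) = op_add (\<pi> a) (\<pi> b)) \<and>
     (\<forall>c a. \<pi> (qscale Q c a) = op_scale H c (\<pi> a)) \<and>
     (\<forall>a. \<pi> (qstar Q a) = op_dag H (\<pi> a)) \<and>
     (\<forall>a. \<forall>x\<in>qcore Q. weak_prod_defined H D (\<pi> a) (\<pi> x) \<and>
                      weak_prod H (\<pi> a) (\<pi> x) = \<pi> (qmul Q a x)) \<and>
     (\<forall>e. quasi_unit Q e \<longrightarrow> \<pi> e = Id_on D)"

text \<open>
  The domain of the closure of a representation: limits in \<open>H\<close> of the filters on \<open>D\<close> that are
  Cauchy for the graph topology.
\<close>

definition closure_domain ::
    "'h::ab_group_add hspace \<Rightarrow> 'h set \<Rightarrow> ('a \<Rightarrow> 'h operator) \<Rightarrow> 'h set" where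
  "closure_domain H D \<pi> =
     {\<xi>. \<exists>F. seminorm_cauchy D (-) (insert (hnorm H) (range (\<lambda>a \<eta>. hnorm H (op_val (\<pi> a) \<eta>)))) F \<and>
             limitin (htop H) (\<lambda>\<eta>. \<eta>) \<xi> F}"

definition closure_rep ::
    "'h::ab_group_add hspace \<Rightarrow> 'h set \<Rightarrow> ('a \<Rightarrow> 'h operator) \<Rightarrow> 'a \<Rightarrow> 'h operator" where
  "closure_rep H D \<pi> a = {(\<xi>, \<eta>) \<in> op_closure H (\<pi> a). \<xi> \<in> closure_domain H D \<pi>}"


section \<open>Forms on a quasi *-algebra and their Hilbert spaces\<close>

definition Q_forms :: "'a::ab_group_add quasi \<Rightarrow> 'a form set" where
  "Q_forms Q = {\<phi>. sesquilinear (qscale Q) \<phi> \<and> positive_form \<phi> \<and>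
     (\<forall>a. \<forall>x\<in>qcore Q. \<forall>y\<in>qcore Q. \<phi> (qmul Q a x) y = \<phi> x (qmul Q (qstar Q a) y))}"

text \<open>
  The Hilbert space completion of the quotient of the algebra by the null space of a form is
  realised by functions on the algebra: the class of \<open>a\<close> is the function \<open>\<phi> a\<close>, that
  is, \<open>b \<mapsto> \<phi>(a, b)\<close> (which vanishes iff \<open>\<phi>(a, a) = 0\<close>), and the limit of a Cauchy sequence
  \<open>(s\<^sub>n)\<close> is the function \<open>b \<mapsto> lim \<phi>(s\<^sub>n, b)\<close>.  By \<open>gns_hilbert_space\<close>,
  \<open>gns_map_linear\<close>, \<open>gns_map_inner\<close>, \<open>gns_map_eq_0_iff\<close> and \<open>gns_map_dense\<close> below, this is a
  Hilbert space in which the quotient is linearly, isometrically and densely embedded.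
\<close>

definition form_cauchy :: "'a::ab_group_add form \<Rightarrow> (nat \<Rightarrow> 'a) \<Rightarrow> bool" where
  "form_cauchy \<phi> s \<longleftrightarrow> (\<forall>\<epsilon>>0. \<exists>N. \<forall>m\<ge>N. \<forall>n\<ge>N. form_norm \<phi> (s m - s n) < \<epsilon>)"

definition gns_represents :: "'a::ab_group_add form \<Rightarrow> (nat \<Rightarrow> 'a) \<Rightarrow> ('a \<Rightarrow> complex) \<Rightarrow> bool" where
  "gns_represents \<phi> s f \<longleftrightarrow> form_cauchy \<phi> s \<and> (\<forall>b. (\<lambda>n. \<phi> (s n) b) \<longlonglongrightarrow> f b)"

definition gns_space :: "'a::ab_group_add form \<Rightarrow> ('a \<Rightarrow> complex) hspace" where
  "gns_space \<phi> =
     \<lparr> hcarrier = {f. \<exists>s. gns_represents \<phi> s f},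
       hscale = (\<lambda>c f b. c * f b),
       hinner = (\<lambda>f g. THE z. \<exists>s t. gns_represents \<phi> s f \<and> gns_represents \<phi> t g \<and>
                                   (\<lambda>n. \<phi> (s n) (t n)) \<longlonglongrightarrow> z) \<rparr>"

definition gns_map :: "'a form \<Rightarrow> 'a \<Rightarrow> ('a \<Rightarrow> complex)" where
  "gns_map \<phi> a = (\<lambda>b. \<phi> a b)"

context
  fixes sc :: "complex \<Rightarrow> 'a::ab_group_add \<Rightarrow> 'a" and \<phi> :: "'a form"
  assumes vs: "vector_space sc" and sesq: "sesquilinear sc \<phi>" and pos: "positive_form \<phi>"
begin

lemma form_herm: "\<phi> b a = cnj (\<phi> a b)"
proof -
  note S = sesqD[OF vs sesq]
  have I: "Im (\<phi> d d) = 0" for d using pos by (auto simp: positive_form_def complex_is_Real_iff)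
  have "Im (\<phi> (a + b) (a + b)) = 0" "Im (\<phi> (a + sc \<i> b) (a + sc \<i> b)) = 0" by (rule I)+
  then have "Im (\<phi> a b) + Im (\<phi> b a) = 0" "Re (\<phi> b a) - Re (\<phi> a b) = 0"
    using I[of a] I[of b] by (simp_all add: S(1-4))
  then show ?thesis by (simp add: complex_eq_iff)
qed

lemma form_pos: "0 \<le> Re (\<phi> a a)"
  using pos by (simp add: positive_form_def)

lemma form_cs: "cmod (\<phi> a b) \<le> form_norm \<phi> a * form_norm \<phi> b"
  by (rule semidefinite_cauchy_schwarz[where V = UNIV and sc = sc])
     (auto simp: sesqD[OF vs sesq] form_pos intro: form_herm)

lemma form_triangle: "form_norm \<phi> (a + b) \<le> form_norm \<phi> a + form_norm \<phi> b"
  by (rule semidefinite_triangle[where V = UNIV and sc = sc])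
     (auto simp: sesqD[OF vs sesq] form_pos intro: form_herm)

lemma form_norm_nonneg: "0 \<le> form_norm \<phi> a"
  using form_pos by (simp add: form_norm_def)

lemma form_norm_minus: "form_norm \<phi> (a - b) = form_norm \<phi> (b - a)"
  by (simp add: form_norm_def sesqD[OF vs sesq])

lemma form_norm_zero: "form_norm \<phi> 0 = 0"
  by (simp add: form_norm_def sesqD[OF vs sesq])

lemma form_norm_scale: "form_norm \<phi> (sc c a) = cmod c * form_norm \<phi> a"
proof -
  have "\<phi> (sc c a) (sc c a) = of_real ((cmod c)\<^sup>2) * \<phi> a a"
    by (simp add: sesqD[OF vs sesq] complex_norm_square algebra_simps del: of_real_power)
  then show ?thesis by (simp add: form_norm_def real_sqrt_mult)
qed

lemma form_norm_sq: "\<phi> a a = of_real ((form_norm \<phi> a)\<^sup>2)"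
  using form_pos[of a] pos by (auto simp: form_norm_def complex_eq_iff positive_form_def complex_is_Real_iff)

lemma form_cauchy_bounded:
  assumes "form_cauchy \<phi> s"
  obtains B where "0 < B" "\<And>n. form_norm \<phi> (s n) \<le> B"
proof -
  obtain N where N: "\<forall>m\<ge>N. \<forall>n\<ge>N. form_norm \<phi> (s m - s n) < 1"
    using assms unfolding form_cauchy_def by (meson zero_less_one)
  define B where "B = 1 + form_norm \<phi> (s N) + (\<Sum>n<N. form_norm \<phi> (s n))"
  have "form_norm \<phi> (s n) \<le> B" for n
  proof (cases "n < N")
    case True
    then have "form_norm \<phi> (s n) \<le> (\<Sum>n<N. form_norm \<phi> (s n))"
      by (intro member_le_sum) (auto simp: form_norm_nonneg)
    then show ?thesis using form_norm_nonneg[of "s N"] by (simp add: B_def)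
  next
    case False
    then have "form_norm \<phi> (s n - s N) < 1" using N by simp
    moreover have "0 \<le> (\<Sum>n<N. form_norm \<phi> (s n))" by (simp add: form_norm_nonneg sum_nonneg)
    ultimately show ?thesis
      using form_triangle[of "s n - s N" "s N"] by (simp add: B_def)
  qed
  moreover have "0 < B" using form_norm_nonneg by (simp add: B_def add_pos_nonneg sum_nonneg)
  ultimately show ?thesis using that by blast
qed

lemma form_cauchy_convergent:
  assumes s: "form_cauchy \<phi> s" and t: "form_cauchy \<phi> t"
  shows "convergent (\<lambda>n. \<phi> (s n) (t n))"
proof -
  obtain B where B: "0 < B" "\<And>n. form_norm \<phi> (s n) \<le> B" using form_cauchy_bounded[OF s] by blast
  obtain C where C: "0 < C" "\<And>n. form_norm \<phi> (t n) \<le> C" using form_cauchy_bounded[OF t] by blast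
  have "Cauchy (\<lambda>n. \<phi> (s n) (t n))"
  proof (rule metric_CauchyI)
    fix e :: real assume e: "0 < e"
    obtain M where M: "\<forall>m\<ge>M. \<forall>n\<ge>M. form_norm \<phi> (s m - s n) < e / (2 * C)"
      using s e C(1) unfolding form_cauchy_def by (meson divide_pos_pos mult_pos_pos zero_less_numeral)
    obtain N where N: "\<forall>m\<ge>N. \<forall>n\<ge>N. form_norm \<phi> (t m - t n) < e / (2 * B)"
      using t e B(1) unfolding form_cauchy_def by (meson divide_pos_pos mult_pos_pos zero_less_numeral)
    have "dist (\<phi> (s m) (t m)) (\<phi> (s n) (t n)) < e" if "max M N \<le> m" "max M N \<le> n" for m n
    proof -
      have "\<phi> (s m) (t m) - \<phi> (s n) (t n) = \<phi> (s m - s n) (t m) + \<phi> (s n) (t m - t n)"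
        by (simp add: sesqD[OF vs sesq])
      then have "dist (\<phi> (s m) (t m)) (\<phi> (s n) (t n))
            \<le> cmod (\<phi> (s m - s n) (t m)) + cmod (\<phi> (s n) (t m - t n))"
        by (simp add: dist_norm norm_triangle_ineq)
      also have "\<dots> \<le> form_norm \<phi> (s m - s n) * C + B * form_norm \<phi> (t m - t n)"
        by (intro add_mono order_trans[OF form_cs] mult_mono) (auto simp: B C form_norm_nonneg less_imp_le)
      also have "\<dots> < e / (2 * C) * C + B * (e / (2 * B))"
        using M N that B C by (intro add_strict_mono mult_strict_right_mono mult_strict_left_mono) auto
      also have "\<dots> = e" using B C by (simp add: field_simps)
      finally show ?thesis .
    qed
    then show "\<exists>M. \<forall>m\<ge>M. \<forall>n\<ge>M. dist (\<phi> (s m) (t m)) (\<phi> (s n) (t n)) < e" by blast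
  qed
  then show ?thesis by (simp add: Cauchy_convergent)
qed

lemma form_cauchy_const: "form_cauchy \<phi> (\<lambda>n. a)"
  by (simp add: form_cauchy_def form_norm_zero)

lemma form_cauchy_add:
  assumes s: "form_cauchy \<phi> s" and t: "form_cauchy \<phi> t"
  shows "form_cauchy \<phi> (\<lambda>n. s n + t n)"
  unfolding form_cauchy_def
proof (intro allI impI)
  fix e :: real assume e: "0 < e"
  obtain M where M: "\<forall>m\<ge>M. \<forall>n\<ge>M. form_norm \<phi> (s m - s n) < e / 2"
    using s e unfolding form_cauchy_def by (meson half_gt_zero)
  obtain N where N: "\<forall>m\<ge>N. \<forall>n\<ge>N. form_norm \<phi> (t m - t n) < e / 2"
    using t e unfolding form_cauchy_def by (meson half_gt_zero)
  have "form_norm \<phi> (s m + t m - (s n + t n)) < e" if "max M N \<le> m" "max M N \<le> n" for m n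
  proof -
    have "form_norm \<phi> (s m - s n) < e / 2" "form_norm \<phi> (t m - t n) < e / 2"
      using M N that by auto
    moreover have eq: "s m + t m - (s n + t n) = (s m - s n) + (t m - t n)" by simp
    ultimately show ?thesis
      unfolding eq using form_triangle[of "s m - s n" "t m - t n"] by linarith
  qed
  then show "\<exists>N. \<forall>m\<ge>N. \<forall>n\<ge>N. form_norm \<phi> (s m + t m - (s n + t n)) < e" by blast
qed

lemma form_cauchy_scale:
  assumes s: "form_cauchy \<phi> s"
  shows "form_cauchy \<phi> (\<lambda>n. sc c (s n))"
  unfolding form_cauchy_def
proof (intro allI impI)
  interpret vector_space sc by (rule vs)
  fix e :: real assume e: "0 < e"
  obtain M where M: "\<forall>m\<ge>M. \<forall>n\<ge>M. form_norm \<phi> (s m - s n) < e / (cmod c + 1)"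
    using s e unfolding form_cauchy_def by (meson divide_pos_pos add_nonneg_pos norm_ge_zero zero_less_one)
  have "form_norm \<phi> (sc c (s m) - sc c (s n)) < e" if "M \<le> m" "M \<le> n" for m n
  proof -
    have "form_norm \<phi> (sc c (s m) - sc c (s n)) = cmod c * form_norm \<phi> (s m - s n)"
      by (metis form_norm_scale scale_right_diff_distrib)
    also have "\<dots> \<le> cmod c * (e / (cmod c + 1))"
      using M[rule_format, OF that] by (intro mult_left_mono) simp_all
    also have "\<dots> < e"
    proof -
      have "cmod c * e < e * (cmod c + 1)" using e by (simp add: algebra_simps)
      moreover have "0 < cmod c + 1" by (simp add: add_nonneg_pos)
      ultimately show ?thesis by (simp add: pos_divide_less_eq)
    qed
    finally show ?thesis .
  qed
  then show "\<exists>N. \<forall>m\<ge>N. \<forall>n\<ge>N. form_norm \<phi> (sc c (s m) - sc c (s n)) < e" by blast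
qed

lemma gns_represents_const: "gns_represents \<phi> (\<lambda>n. a) (\<phi> a)"
  by (simp add: gns_represents_def form_cauchy_const)

lemma gns_represents_add:
  "gns_represents \<phi> s f \<Longrightarrow> gns_represents \<phi> t g \<Longrightarrow> gns_represents \<phi> (\<lambda>n. s n + t n) (f + g)"
  by (auto simp: gns_represents_def form_cauchy_add sesqD[OF vs sesq] intro!: tendsto_add)

lemma gns_represents_scale:
  "gns_represents \<phi> s f \<Longrightarrow> gns_represents \<phi> (\<lambda>n. sc c (s n)) (\<lambda>b. c * f b)"
  by (auto simp: gns_represents_def form_cauchy_scale sesqD[OF vs sesq] intro!: tendsto_mult)

lemma gns_represents_diff:
  assumes "gns_represents \<phi> s f" "gns_represents \<phi> t g"
  shows "gns_represents \<phi> (\<lambda>n. s n - t n) (f - g)"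
proof -
  interpret vector_space sc by (rule vs)
  have "gns_represents \<phi> (\<lambda>n. s n + sc (-1) (t n)) (f + (\<lambda>b. (-1) * g b))"
    using gns_represents_add gns_represents_scale assms by blast
  moreover have "f + (\<lambda>b. (-1) * g b) = f - g" by (simp add: fun_eq_iff)
  ultimately show ?thesis by simp
qed

lemma gns_represents_zero_limit:
  assumes s: "gns_represents \<phi> s 0"
  shows "(\<lambda>n. form_norm \<phi> (s n)) \<longlonglongrightarrow> 0"
proof -
  have c: "form_cauchy \<phi> s" and l: "\<And>b. (\<lambda>n. \<phi> (s n) b) \<longlonglongrightarrow> 0"
    using s by (auto simp: gns_represents_def)
  obtain B where B: "0 < B" "\<And>n. form_norm \<phi> (s n) \<le> B" using form_cauchy_bounded[OF c] by blast
  have "(\<lambda>n. (form_norm \<phi> (s n))\<^sup>2) \<longlonglongrightarrow> 0"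
  proof (rule LIMSEQ_I)
    fix e :: real assume e: "0 < e"
    obtain M where M: "\<forall>m\<ge>M. \<forall>n\<ge>M. form_norm \<phi> (s m - s n) < e / (2 * B)"
      using c e B(1) unfolding form_cauchy_def by (meson divide_pos_pos mult_pos_pos zero_less_numeral)
    obtain N where N: "\<forall>n\<ge>N. cmod (\<phi> (s n) (s M)) < e / 2"
      using LIMSEQ_D[OF l[of "s M"], of "e / 2"] e by auto
    have "norm ((form_norm \<phi> (s n))\<^sup>2 - 0) < e" if "max M N \<le> n" for n
    proof -
      have "(form_norm \<phi> (s n))\<^sup>2 = cmod (\<phi> (s n) (s n))"
        by (subst form_norm_sq) (simp add: norm_power)
      also have "\<phi> (s n) (s n) = \<phi> (s n) (s n - s M) + \<phi> (s n) (s M)"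
        by (simp add: sesqD[OF vs sesq])
      also have "cmod \<dots> \<le> form_norm \<phi> (s n) * form_norm \<phi> (s n - s M) + cmod (\<phi> (s n) (s M))"
        using norm_triangle_ineq form_cs by (metis add_mono order_trans order_refl)
      also have "\<dots> < B * (e / (2 * B)) + e / 2"
      proof (intro add_le_less_mono mult_mono)
        show "form_norm \<phi> (s n - s M) \<le> e / (2 * B)" using M that by (simp add: less_imp_le)
      qed (use B N that in \<open>auto simp: form_norm_nonneg\<close>)
      also have "\<dots> = e" using B by (simp add: field_simps)
      finally show ?thesis by simp
    qed
    then show "\<exists>N. \<forall>n\<ge>N. norm ((form_norm \<phi> (s n))\<^sup>2 - 0) < e" by blast
  qed
  then have "(\<lambda>n. sqrt ((form_norm \<phi> (s n))\<^sup>2)) \<longlonglongrightarrow> sqrt 0" by (rule tendsto_real_sqrt)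
  then show ?thesis by (simp add: form_norm_nonneg)
qed

lemma gns_inner_limit:
  assumes s: "gns_represents \<phi> s f" and t: "gns_represents \<phi> t g"
  shows "(\<lambda>n. \<phi> (s n) (t n)) \<longlonglongrightarrow> hinner (gns_space \<phi>) f g"
proof -
  have cs: "form_cauchy \<phi> s" and ct: "form_cauchy \<phi> t" using s t by (auto simp: gns_represents_def)
  obtain z where z: "(\<lambda>n. \<phi> (s n) (t n)) \<longlonglongrightarrow> z"
    using form_cauchy_convergent[OF cs ct] by (auto simp: convergent_def)
  have uniq: "w = z" if s': "gns_represents \<phi> s' f" and t': "gns_represents \<phi> t' g"
    and w: "(\<lambda>n. \<phi> (s' n) (t' n)) \<longlonglongrightarrow> w" for s' t' w
  proof -
    have ct': "form_cauchy \<phi> t'" using t' by (simp add: gns_represents_def)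
    obtain B where B: "0 < B" "\<And>n. form_norm \<phi> (s n) \<le> B" using form_cauchy_bounded[OF cs] by blast
    obtain C where C: "0 < C" "\<And>n. form_norm \<phi> (t' n) \<le> C" using form_cauchy_bounded[OF ct'] by blast
    have ds: "(\<lambda>n. form_norm \<phi> (s' n - s n)) \<longlonglongrightarrow> 0" and dt: "(\<lambda>n. form_norm \<phi> (t' n - t n)) \<longlonglongrightarrow> 0"
      using gns_represents_zero_limit gns_represents_diff[OF s' s] gns_represents_diff[OF t' t] by auto
    have L: "(\<lambda>n. form_norm \<phi> (s' n - s n) * C + B * form_norm \<phi> (t' n - t n)) \<longlonglongrightarrow> 0 * C + B * 0"
      by (intro tendsto_intros ds dt)
    have "(\<lambda>n. \<phi> (s' n) (t' n) - \<phi> (s n) (t n)) \<longlonglongrightarrow> 0"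
    proof (rule Lim_null_comparison[OF always_eventually[OF allI]])
      fix n
      have "\<phi> (s' n) (t' n) - \<phi> (s n) (t n) = \<phi> (s' n - s n) (t' n) + \<phi> (s n) (t' n - t n)"
        by (simp add: sesqD[OF vs sesq])
      then have "cmod (\<phi> (s' n) (t' n) - \<phi> (s n) (t n))
           \<le> cmod (\<phi> (s' n - s n) (t' n)) + cmod (\<phi> (s n) (t' n - t n))"
        by (simp add: norm_triangle_ineq)
      also have "\<dots> \<le> form_norm \<phi> (s' n - s n) * C + B * form_norm \<phi> (t' n - t n)"
        by (intro add_mono order_trans[OF form_cs] mult_mono) (auto simp: B C form_norm_nonneg less_imp_le)
      finally show "cmod (\<phi> (s' n) (t' n) - \<phi> (s n) (t n)) \<le> form_norm \<phi> (s' n - s n) * C + B * form_norm \<phi> (t' n - t n)" .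
    qed (use L in simp)
    then have "w - z = 0" using tendsto_diff[OF w z] LIMSEQ_unique by blast
    then show ?thesis by simp
  qed
  have "hinner (gns_space \<phi>) f g = z"
    unfolding gns_space_def hspace.select_convs
    by (rule the_equality) (use s t z uniq in blast)+
  then show ?thesis using z by simp
qed

lemma gns_norm_limit:
  assumes s: "gns_represents \<phi> s f"
  shows "(\<lambda>n. form_norm \<phi> (s n)) \<longlonglongrightarrow> hnorm (gns_space \<phi>) f"
  using tendsto_real_sqrt[OF tendsto_Re[OF gns_inner_limit[OF s s]]]
  by (simp add: form_norm_def hnorm_def)

lemma gns_map_carrier: "gns_map \<phi> a \<in> hcarrier (gns_space \<phi>)"
  using gns_represents_const[of a] by (auto simp: gns_space_def gns_map_def)

lemma gns_map_inner: "hinner (gns_space \<phi>) (gns_map \<phi> a) (gns_map \<phi> b) = \<phi> a b"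
  using gns_inner_limit[OF gns_represents_const gns_represents_const, of a b]
  by (simp add: gns_map_def LIMSEQ_const_iff)

lemma gns_map_linear:
  "gns_map \<phi> (a + b) = gns_map \<phi> a + gns_map \<phi> b"
  "gns_map \<phi> (sc c a) = hscale (gns_space \<phi>) c (gns_map \<phi> a)"
  by (simp_all add: gns_map_def gns_space_def fun_eq_iff sesqD[OF vs sesq])

lemma gns_map_eq_0_iff: "gns_map \<phi> a = 0 \<longleftrightarrow> \<phi> a a = 0"
proof
  assume "\<phi> a a = 0"
  then have "\<phi> a b = 0" for b using form_cs[of a b] by (simp add: form_norm_def)
  then show "gns_map \<phi> a = 0" by (simp add: gns_map_def fun_eq_iff)
qed (simp add: gns_map_def fun_eq_iff)

lemma gns_hilbert_algebraic:
  shows "vector_space (hscale (gns_space \<phi>))"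
    and "module.subspace (hscale (gns_space \<phi>)) (hcarrier (gns_space \<phi>))"
    and "\<lbrakk>f \<in> hcarrier (gns_space \<phi>); g \<in> hcarrier (gns_space \<phi>); h \<in> hcarrier (gns_space \<phi>)\<rbrakk> \<Longrightarrow>
           hinner (gns_space \<phi>) (f + g) h = hinner (gns_space \<phi>) f h + hinner (gns_space \<phi>) g h"
    and "\<lbrakk>f \<in> hcarrier (gns_space \<phi>); g \<in> hcarrier (gns_space \<phi>)\<rbrakk> \<Longrightarrow>
           hinner (gns_space \<phi>) (hscale (gns_space \<phi>) c f) g = c * hinner (gns_space \<phi>) f g"
    and "\<lbrakk>f \<in> hcarrier (gns_space \<phi>); g \<in> hcarrier (gns_space \<phi>)\<rbrakk> \<Longrightarrow>
           hinner (gns_space \<phi>) g f = cnj (hinner (gns_space \<phi>) f g)"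
    and "f \<in> hcarrier (gns_space \<phi>) \<Longrightarrow> 0 \<le> Re (hinner (gns_space \<phi>) f f)"
    and "f \<in> hcarrier (gns_space \<phi>) \<Longrightarrow> f \<noteq> 0 \<Longrightarrow> 0 < Re (hinner (gns_space \<phi>) f f)"
proof -
  have rep: "\<exists>s. gns_represents \<phi> s f" if "f \<in> hcarrier (gns_space \<phi>)" for f
    using that by (simp add: gns_space_def)
  show V: "vector_space (hscale (gns_space \<phi>))"
    by unfold_locales (simp_all add: gns_space_def fun_eq_iff algebra_simps)
  interpret V: vector_space "hscale (gns_space \<phi>)" by (rule V)
  show "module.subspace (hscale (gns_space \<phi>)) (hcarrier (gns_space \<phi>))"
  proof (rule V.subspaceI)
    have "gns_map \<phi> 0 = 0" by (simp add: gns_map_def sesqD[OF vs sesq] fun_eq_iff)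
    then show "0 \<in> hcarrier (gns_space \<phi>)" using gns_map_carrier[of 0] by simp
  qed (use gns_represents_add gns_represents_scale in \<open>fastforce simp: gns_space_def\<close>)+
  show "hinner (gns_space \<phi>) (f + g) h = hinner (gns_space \<phi>) f h + hinner (gns_space \<phi>) g h"
    if fgh: "f \<in> hcarrier (gns_space \<phi>)" "g \<in> hcarrier (gns_space \<phi>)" "h \<in> hcarrier (gns_space \<phi>)"
  proof -
    from fgh rep obtain s t u where
      stu: "gns_represents \<phi> s f" "gns_represents \<phi> t g" "gns_represents \<phi> u h" by meson
    have "(\<lambda>n. \<phi> (s n) (u n) + \<phi> (t n) (u n)) \<longlonglongrightarrow> hinner (gns_space \<phi>) f h + hinner (gns_space \<phi>) g h"
      by (intro tendsto_add gns_inner_limit stu)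
    moreover have "(\<lambda>n. \<phi> (s n) (u n) + \<phi> (t n) (u n)) \<longlonglongrightarrow> hinner (gns_space \<phi>) (f + g) h"
      using gns_inner_limit[OF gns_represents_add[OF stu(1,2)] stu(3)] by (simp add: sesqD[OF vs sesq])
    ultimately show ?thesis using LIMSEQ_unique by blast
  qed
  show "hinner (gns_space \<phi>) (hscale (gns_space \<phi>) c f) g = c * hinner (gns_space \<phi>) f g"
    if fg: "f \<in> hcarrier (gns_space \<phi>)" "g \<in> hcarrier (gns_space \<phi>)"
  proof -
    from fg rep obtain s t where st: "gns_represents \<phi> s f" "gns_represents \<phi> t g" by meson
    have "(\<lambda>n. c * \<phi> (s n) (t n)) \<longlonglongrightarrow> c * hinner (gns_space \<phi>) f g"
      by (intro tendsto_mult gns_inner_limit st tendsto_const)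
    moreover have "(\<lambda>n. c * \<phi> (s n) (t n)) \<longlonglongrightarrow> hinner (gns_space \<phi>) (\<lambda>b. c * f b) g"
      using gns_inner_limit[OF gns_represents_scale[OF st(1), of c] st(2)] by (simp add: sesqD[OF vs sesq])
    moreover have "hscale (gns_space \<phi>) c f = (\<lambda>b. c * f b)" by (simp add: gns_space_def)
    ultimately show ?thesis using LIMSEQ_unique by metis
  qed
  show "hinner (gns_space \<phi>) g f = cnj (hinner (gns_space \<phi>) f g)"
    if fg: "f \<in> hcarrier (gns_space \<phi>)" "g \<in> hcarrier (gns_space \<phi>)"
  proof -
    from fg rep obtain s t where st: "gns_represents \<phi> s f" "gns_represents \<phi> t g" by meson
    have "(\<lambda>n. cnj (\<phi> (s n) (t n))) \<longlonglongrightarrow> cnj (hinner (gns_space \<phi>) f g)"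
      by (intro tendsto_cnj gns_inner_limit st)
    then have "(\<lambda>n. \<phi> (t n) (s n)) \<longlonglongrightarrow> cnj (hinner (gns_space \<phi>) f g)"
      by (simp flip: form_herm)
    then show ?thesis using gns_inner_limit[OF st(2,1)] LIMSEQ_unique by blast
  qed
  show nn: "0 \<le> Re (hinner (gns_space \<phi>) f f)" if f: "f \<in> hcarrier (gns_space \<phi>)"
  proof -
    from f rep obtain s where s: "gns_represents \<phi> s f" by meson
    show ?thesis
      by (rule LIMSEQ_le_const[OF tendsto_Re[OF gns_inner_limit[OF s s]]]) (use form_pos in auto)
  qed
  show "0 < Re (hinner (gns_space \<phi>) f f)" if f: "f \<in> hcarrier (gns_space \<phi>)" and "f \<noteq> 0"
  proof (rule ccontr)
    assume "\<not> ?thesis"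
    then have "hnorm (gns_space \<phi>) f = 0" using nn[OF f] by (simp add: hnorm_def form_norm_def)
    moreover from f rep obtain s where s: "gns_represents \<phi> s f" by meson
    ultimately have l: "(\<lambda>n. form_norm \<phi> (s n)) \<longlonglongrightarrow> 0" using gns_norm_limit[OF s] by simp
    have "f b = 0" for b
    proof -
      have "(\<lambda>n. form_norm \<phi> (s n) * form_norm \<phi> b) \<longlonglongrightarrow> 0 * form_norm \<phi> b"
        by (intro tendsto_intros l)
      then have "(\<lambda>n. \<phi> (s n) b) \<longlonglongrightarrow> 0"
        using Lim_null_comparison[OF always_eventually[OF allI[OF form_cs]], of s "\<lambda>_. b"] by simp
      then show ?thesis using s LIMSEQ_unique by (auto simp: gns_represents_def)
    qed
    then show False using \<open>f \<noteq> 0\<close> by (auto simp: fun_eq_iff)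
  qed
qed

lemma gns_norm_approx:
  assumes s: "gns_represents \<phi> s f"
  shows "(\<lambda>k. hdist (gns_space \<phi>) (gns_map \<phi> (s k)) f) \<longlonglongrightarrow> 0"
proof (rule LIMSEQ_I)
  fix e :: real assume e: "0 < e"
  have fc: "f \<in> hcarrier (gns_space \<phi>)" using s by (auto simp: gns_space_def)
  have "form_cauchy \<phi> s" using s by (simp add: gns_represents_def)
  then obtain N where N: "\<forall>m\<ge>N. \<forall>n\<ge>N. form_norm \<phi> (s m - s n) < e / 2"
    using e unfolding form_cauchy_def by (meson half_gt_zero)
  have "norm (hdist (gns_space \<phi>) (gns_map \<phi> (s k)) f - 0) < e" if "N \<le> k" for k
  proof -
    have "gns_represents \<phi> (\<lambda>n. s k - s n) (gns_map \<phi> (s k) - f)"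
      using gns_represents_diff[OF gns_represents_const s] by (simp add: gns_map_def)
    then have l: "(\<lambda>n. form_norm \<phi> (s k - s n)) \<longlonglongrightarrow> hdist (gns_space \<phi>) (gns_map \<phi> (s k)) f"
      using gns_norm_limit gns_map_carrier[of "s k"] fc by (simp add: hdist_def norm_dist_def)
    have "hdist (gns_space \<phi>) (gns_map \<phi> (s k)) f \<le> e / 2"
      by (rule LIMSEQ_le_const2[OF l]) (use N that in \<open>auto intro!: exI[of _ N] less_imp_le\<close>)
    moreover have "0 \<le> hdist (gns_space \<phi>) (gns_map \<phi> (s k)) f"
      by (rule LIMSEQ_le_const[OF l]) (auto simp: form_norm_nonneg)
    ultimately show ?thesis using e by simp
  qed
  then show "\<exists>N. \<forall>k\<ge>N. norm (hdist (gns_space \<phi>) (gns_map \<phi> (s k)) f - 0) < e" by blast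
qed

lemma gns_inner_product_space: "inner_product_space (gns_space \<phi>)"
  using gns_hilbert_algebraic by (intro inner_product_space.intro)

lemma gns_hilbert_space: "hilbert_space (gns_space \<phi>)"
proof -
  interpret I: inner_product_space "gns_space \<phi>" by (rule gns_inner_product_space)
  interpret M: Metric_space "hcarrier (gns_space \<phi>)" "hdist (gns_space \<phi>)"
    by (rule I.Metric_space_hdist)
  let ?d = "hdist (gns_space \<phi>)"
  have dist_map: "?d (gns_map \<phi> a) (gns_map \<phi> b) = form_norm \<phi> (a - b)" for a b
  proof -
    have "gns_map \<phi> a - gns_map \<phi> b = gns_map \<phi> (a - b)"
      by (simp add: gns_map_def fun_eq_iff sesqD[OF vs sesq])
    then show ?thesis
      by (simp add: hdist_def norm_dist_def gns_map_carrier hnorm_def form_norm_def gns_map_inner)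
  qed
  have "\<exists>f. limitin M.mtopology \<sigma> f sequentially" if \<sigma>: "M.MCauchy \<sigma>" for \<sigma>
  proof -
    have car: "\<sigma> n \<in> hcarrier (gns_space \<phi>)" for n using \<sigma> by (auto simp: M.MCauchy_def)
    have "\<exists>a. ?d (gns_map \<phi> a) (\<sigma> n) < inverse (real (Suc n))" for n
    proof -
      obtain s where s: "gns_represents \<phi> s (\<sigma> n)" using car[of n] by (auto simp: gns_space_def)
      have "eventually (\<lambda>k. ?d (gns_map \<phi> (s k)) (\<sigma> n) < inverse (real (Suc n))) sequentially"
        using gns_norm_approx[OF s] by (rule order_tendstoD) simp
      then show ?thesis by (auto simp: eventually_sequentially)
    qed
    then obtain a where a: "\<And>n. ?d (gns_map \<phi> (a n)) (\<sigma> n) < inverse (real (Suc n))" by metis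
    have cau: "form_cauchy \<phi> a"
      unfolding form_cauchy_def
    proof (intro allI impI)
      fix e :: real assume e: "0 < e"
      obtain N where N: "\<And>m n. N \<le> m \<Longrightarrow> N \<le> n \<Longrightarrow> ?d (\<sigma> m) (\<sigma> n) < e / 3"
        using \<sigma> e unfolding M.MCauchy_def by (meson divide_pos_pos zero_less_numeral)
      obtain K where K: "inverse (real (Suc K)) < e / 3" using reals_Archimedean[of "e / 3"] e by auto
      have "form_norm \<phi> (a m - a n) < e" if mn: "max N K \<le> m" "max N K \<le> n" for m n
      proof -
        have inv: "?d (gns_map \<phi> (a k)) (\<sigma> k) < e / 3" if "K \<le> k" for k
        proof -
          have "inverse (real (Suc k)) \<le> inverse (real (Suc K))" using that by (simp add: field_simps)
          then show ?thesis using a[of k] K by linarith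
        qed
        have "form_norm \<phi> (a m - a n) \<le> ?d (gns_map \<phi> (a m)) (\<sigma> m) + ?d (\<sigma> m) (gns_map \<phi> (a n))"
          using M.triangle[of "gns_map \<phi> (a m)" "\<sigma> m" "gns_map \<phi> (a n)"] by (simp add: car gns_map_carrier dist_map)
        also have "?d (\<sigma> m) (gns_map \<phi> (a n)) \<le> ?d (\<sigma> m) (\<sigma> n) + ?d (gns_map \<phi> (a n)) (\<sigma> n)"
          using M.triangle[of "\<sigma> m" "\<sigma> n" "gns_map \<phi> (a n)"] M.commute[of "\<sigma> n"]
          by (simp add: car gns_map_carrier)
        finally show ?thesis using inv[of m] inv[of n] N[of m n] mn by simp
      qed
      then show "\<exists>N. \<forall>m\<ge>N. \<forall>n\<ge>N. form_norm \<phi> (a m - a n) < e" by blast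
    qed
    define f where "f b = lim (\<lambda>n. \<phi> (a n) b)" for b
    have f: "gns_represents \<phi> a f"
      using cau form_cauchy_convergent[OF cau form_cauchy_const]
      by (simp add: gns_represents_def f_def convergent_LIMSEQ_iff)
    then have fc: "f \<in> hcarrier (gns_space \<phi>)" by (auto simp: gns_space_def)
    have "(\<lambda>n. ?d (\<sigma> n) f) \<longlonglongrightarrow> 0"
    proof (rule Lim_null_comparison[where g = "\<lambda>n. inverse (real (Suc n)) + ?d (gns_map \<phi> (a n)) f"])
      show "\<forall>\<^sub>F n in sequentially. norm (?d (\<sigma> n) f) \<le> inverse (real (Suc n)) + ?d (gns_map \<phi> (a n)) f"
      proof (intro always_eventually allI)
        fix n
        show "norm (?d (\<sigma> n) f) \<le> inverse (real (Suc n)) + ?d (gns_map \<phi> (a n)) f"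
          using M.triangle[OF car[of n] gns_map_carrier[of "a n"] fc] a[of n] M.commute[of "\<sigma> n"] by simp
      qed
      show "(\<lambda>n. inverse (real (Suc n)) + ?d (gns_map \<phi> (a n)) f) \<longlonglongrightarrow> 0"
        using tendsto_add[OF LIMSEQ_inverse_real_of_nat gns_norm_approx[OF f]] by simp
    qed
    then show ?thesis
      using fc car by (auto simp: M.limitin_metric_dist_null)
  qed
  then have "M.mcomplete" by (simp add: M.mcomplete_def)
  then show ?thesis by unfold_locales
qed

lemma gns_map_dense: "htop (gns_space \<phi>) closure_of range (gns_map \<phi>) = hcarrier (gns_space \<phi>)"
proof -
  interpret I: inner_product_space "gns_space \<phi>" by (rule gns_inner_product_space)
  interpret M: Metric_space "hcarrier (gns_space \<phi>)" "hdist (gns_space \<phi>)"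
    by (rule I.Metric_space_hdist)
  have "f \<in> M.mtopology closure_of range (gns_map \<phi>)" if f: "f \<in> hcarrier (gns_space \<phi>)" for f
  proof -
    obtain s where s: "gns_represents \<phi> s f" using f by (auto simp: gns_space_def)
    have "limitin M.mtopology (\<lambda>n. gns_map \<phi> (s n)) f sequentially"
      using gns_norm_approx[OF s] f by (simp add: M.limitin_metric_dist_null gns_map_carrier)
    then show ?thesis
      using f gns_map_carrier
      by (auto simp: M.closure_of_sequentially intro!: exI[of _ "\<lambda>n. gns_map \<phi> (s n)"])
  qed
  then show ?thesis
    using closure_of_subset_topspace[of M.mtopology] by (auto simp: htop_def)
qed

end

definition I_forms :: "'a::ab_group_add quasi \<Rightarrow> 'a form set" where
  "I_forms Q = {\<phi> \<in> Q_forms Q.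
     htop (gns_space \<phi>) closure_of (gns_map \<phi> ` qcore Q) = hcarrier (gns_space \<phi>)}"

definition form_translate :: "'a quasi \<Rightarrow> 'a form \<Rightarrow> 'a \<Rightarrow> 'a form" where
  "form_translate Q \<phi> x = (\<lambda>a b. \<phi> (qmul Q a x) (qmul Q b x))"

definition balanced :: "'a quasi \<Rightarrow> 'a form set \<Rightarrow> bool" where
  "balanced Q M \<longleftrightarrow> (\<forall>\<phi>\<in>M. \<forall>x\<in>qcore Q. form_translate Q \<phi> x \<in> M)"

definition sufficient :: "'a::ab_group_add quasi \<Rightarrow> 'a form set \<Rightarrow> bool" where
  "sufficient Q M \<longleftrightarrow> balanced Q M \<and> (\<forall>a. a \<noteq> 0 \<longrightarrow> (\<exists>\<phi>\<in>M. 0 < Re (\<phi> a a)))"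

definition regular_rep ::
    "'a form set \<Rightarrow> 'h hspace \<Rightarrow> 'h set \<Rightarrow> ('a \<Rightarrow> 'h operator) \<Rightarrow> bool" where
  "regular_rep M H D \<pi> \<longleftrightarrow>
     (\<forall>\<xi>\<in>D. (\<lambda>a b. hinner H (op_val (\<pi> a) \<xi>) (op_val (\<pi> b) \<xi>)) \<in> M)"

definition gns_rep0 :: "'a quasi \<Rightarrow> 'a form \<Rightarrow> 'a \<Rightarrow> ('a \<Rightarrow> complex) operator" where
  "gns_rep0 Q \<phi> a = {(gns_map \<phi> x, gns_map \<phi> (qmul Q a x)) | x. x \<in> qcore Q}"

definition gns_domain :: "'a::ab_group_add quasi \<Rightarrow> 'a form \<Rightarrow> ('a \<Rightarrow> complex) set" where
  "gns_domain Q \<phi> = closure_domain (gns_space \<phi>) (gns_map \<phi> ` qcore Q) (gns_rep0 Q \<phi>)"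

definition gns_rep :: "'a::ab_group_add quasi \<Rightarrow> 'a form \<Rightarrow> 'a \<Rightarrow> ('a \<Rightarrow> complex) operator" where
  "gns_rep Q \<phi> = closure_rep (gns_space \<phi>) (gns_map \<phi> ` qcore Q) (gns_rep0 Q \<phi>)"


section \<open>Bounded elements, condition (C) and GA*-algebras\<close>

definition is_bound :: "'a quasi \<Rightarrow> 'a form set \<Rightarrow> 'a \<Rightarrow> real \<Rightarrow> bool" where
  "is_bound Q M a \<gamma> \<longleftrightarrow> 0 < \<gamma> \<and>
     (\<forall>\<phi>\<in>M. \<forall>x\<in>qcore Q. \<forall>y\<in>qcore Q.
        cmod (\<phi> (qmul Q a x) y) \<le> \<gamma> * form_norm \<phi> x * form_norm \<phi> y)"

definition bounded_elements :: "'a quasi \<Rightarrow> 'a form set \<Rightarrow> 'a set" where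
  "bounded_elements Q M = {a. \<exists>\<gamma>. is_bound Q M a \<gamma>}"

definition bounded_norm :: "'a quasi \<Rightarrow> 'a form set \<Rightarrow> 'a \<Rightarrow> real" where
  "bounded_norm Q M a = Inf {\<gamma>. is_bound Q M a \<gamma>}"

definition is_weak_mult :: "'a quasi \<Rightarrow> 'a form set \<Rightarrow> 'a \<Rightarrow> 'a \<Rightarrow> 'a \<Rightarrow> bool" where
  "is_weak_mult Q M a b c \<longleftrightarrow>
     (\<forall>\<phi>\<in>M. \<forall>x\<in>qcore Q. \<forall>y\<in>qcore Q. \<phi> (qmul Q b x) (qmul Q (qstar Q a) y) = \<phi> (qmul Q c x) y)"

definition weak_mult_defined :: "'a quasi \<Rightarrow> 'a form set \<Rightarrow> 'a \<Rightarrow> 'a \<Rightarrow> bool" where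
  "weak_mult_defined Q M a b \<longleftrightarrow> (\<exists>c. is_weak_mult Q M a b c)"

definition weak_mult :: "'a quasi \<Rightarrow> 'a form set \<Rightarrow> 'a \<Rightarrow> 'a \<Rightarrow> 'a" where
  "weak_mult Q M a b = (THE c. is_weak_mult Q M a b c)"

definition condition_C :: "'a::ab_group_add quasi \<Rightarrow> 'a form set \<Rightarrow> bool" where
  "condition_C Q M \<longleftrightarrow>
     (\<forall>a\<in>bounded_elements Q M. \<forall>b\<in>bounded_elements Q M. \<exists>!c. \<forall>\<phi>\<in>M.
        weak_prod_defined (gns_space \<phi>) (gns_domain Q \<phi>) (gns_rep Q \<phi> a) (gns_rep Q \<phi> b) \<and>
        weak_prod (gns_space \<phi>) (gns_rep Q \<phi> a) (gns_rep Q \<phi> b) = gns_rep Q \<phi> c)"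

definition bounded_family :: "'a form set \<Rightarrow> bool" where
  "bounded_family F \<longleftrightarrow> (\<forall>a. bdd_above ((\<lambda>\<phi>. Re (\<phi> a a)) ` F))"

text \<open>Inserting \<open>0\<close> only fixes the supremum over the empty family.\<close>

definition family_seminorm :: "'a form set \<Rightarrow> 'a \<Rightarrow> real" where
  "family_seminorm F a = Sup (insert 0 ((\<lambda>\<phi>. form_norm \<phi> a) ` F))"

definition family_star_seminorm :: "'a quasi \<Rightarrow> 'a form set \<Rightarrow> 'a \<Rightarrow> real" where
  "family_star_seminorm Q F a = max (family_seminorm F a) (family_seminorm F (qstar Q a))"

definition tau_star_seminorms :: "'a quasi \<Rightarrow> 'a form set \<Rightarrow> ('a \<Rightarrow> real) set" where
  "tau_star_seminorms Q M = {family_star_seminorm Q F | F. F \<subseteq> M \<and> bounded_family F}"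

definition tau_star :: "'a::ab_group_add quasi \<Rightarrow> 'a form set \<Rightarrow> 'a topology" where
  "tau_star Q M = seminorm_topology UNIV (-) (tau_star_seminorms Q M)"

definition strongly_well_behaved :: "'a::ab_group_add quasi \<Rightarrow> 'a form set \<Rightarrow> bool" where
  "strongly_well_behaved Q M \<longleftrightarrow>
     M \<subseteq> I_forms Q \<and> sufficient Q M \<and> qcore Q \<subseteq> bounded_elements Q M \<and> condition_C Q M \<and>
     seminorm_complete UNIV (-) (tau_star_seminorms Q M)"

definition lc_quasi_GA_star_algebra :: "'a::ab_group_add quasi \<Rightarrow> 'a topology \<Rightarrow> bool" where
  "lc_quasi_GA_star_algebra Q \<tau> \<longleftrightarrow>
     lc_quasi_star_algebra Q \<tau> \<and> (\<exists>M. strongly_well_behaved Q M \<and> \<tau> = tau_star Q M)"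


section \<open>C*-algebras\<close>

locale cstar_algebra =
  fixes sc :: "complex \<Rightarrow> 'a::ab_group_add \<Rightarrow> 'a" and B :: "'a set"
    and mul :: "'a \<Rightarrow> 'a \<Rightarrow> 'a" and star :: "'a \<Rightarrow> 'a" and nrm :: "'a \<Rightarrow> real"
  assumes vs: "vector_space sc"
    and subspace: "module.subspace sc B"
    and mul_closed: "\<lbrakk>a \<in> B; b \<in> B\<rbrakk> \<Longrightarrow> mul a b \<in> B"
    and mul_assoc: "\<lbrakk>a \<in> B; b \<in> B; c \<in> B\<rbrakk> \<Longrightarrow> mul (mul a b) c = mul a (mul b c)"
    and mul_add_left: "\<lbrakk>a \<in> B; b \<in> B; c \<in> B\<rbrakk> \<Longrightarrow> mul (a + b) c = mul a c + mul b c"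
    and mul_add_right: "\<lbrakk>a \<in> B; b \<in> B; c \<in> B\<rbrakk> \<Longrightarrow> mul a (b + c) = mul a b + mul a c"
    and mul_scale_left: "\<lbrakk>a \<in> B; b \<in> B\<rbrakk> \<Longrightarrow> mul (sc z a) b = sc z (mul a b)"
    and mul_scale_right: "\<lbrakk>a \<in> B; b \<in> B\<rbrakk> \<Longrightarrow> mul a (sc z b) = sc z (mul a b)"
    and star_closed: "a \<in> B \<Longrightarrow> star a \<in> B"
    and star_star: "a \<in> B \<Longrightarrow> star (star a) = a"
    and star_add: "\<lbrakk>a \<in> B; b \<in> B\<rbrakk> \<Longrightarrow> star (a + b) = star a + star b"
    and star_scale: "a \<in> B \<Longrightarrow> star (sc z a) = sc (cnj z) (star a)"
    and star_mul: "\<lbrakk>a \<in> B; b \<in> B\<rbrakk> \<Longrightarrow> star (mul a b) = mul (star b) (star a)"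
    and norm_nonneg: "a \<in> B \<Longrightarrow> 0 \<le> nrm a"
    and norm_eq_0_iff: "a \<in> B \<Longrightarrow> nrm a = 0 \<longleftrightarrow> a = 0"
    and norm_triangle: "\<lbrakk>a \<in> B; b \<in> B\<rbrakk> \<Longrightarrow> nrm (a + b) \<le> nrm a + nrm b"
    and norm_scale: "a \<in> B \<Longrightarrow> nrm (sc z a) = cmod z * nrm a"
    and norm_mul: "\<lbrakk>a \<in> B; b \<in> B\<rbrakk> \<Longrightarrow> nrm (mul a b) \<le> nrm a * nrm b"
    and cstar_identity: "a \<in> B \<Longrightarrow> nrm (mul (star a) a) = (nrm a)\<^sup>2"
    and complete: "Metric_space.mcomplete B (norm_dist B nrm)"

end

theory Submission
  imports Defs
begin

text \<open>
  Write \<open>|a|\<^sub>\<phi>\<close> for \<open>\<phi>(a, a)\<close> to the power \<open>1/2\<close>, \<open>A\<close> for the quasi *-algebra, \<open>A\<^sub>0\<close> for its core, and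
  \<open>e\<close> for the unit.

  The continuity statements rest on one observation: a single form \<open>\<phi>\<close> in \<open>M\<close> is a bounded family, so that
  \<open>p(a) = max(|a|\<^sub>\<phi>, |a*|\<^sub>\<phi>)\<close> is one of the seminorms that define the topology.  Joint continuity of
  \<open>\<phi>\<close> is then the Cauchy-Schwarz inequality (\<open>form_jointly_continuous\<close>).  For a regular representation
  \<open>\<pi>\<close> and a vector \<open>\<xi>\<close> of its domain, let \<open>\<phi>\<close> be the vector form of \<open>\<xi>\<close>; the strong* seminorm of
  \<open>\<pi>(a)\<close> at \<open>\<xi>\<close> is exactly \<open>p(a)\<close> (\<open>regular_rep_continuous\<close>).  Since the centre of a strong*
  neighbourhood need not be in the range of \<open>\<pi>\<close>, the distance to an arbitrary operator \<open>X\<close> is shown to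
  be Lipschitz with respect to \<open>p\<close>.

  For the C*-algebra, the key is that boundedness can be tested at the unit.  The family is balanced
  and \<open>A\<^sub>0\<close> is dense for each of its forms, so \<open>\<gamma>\<close> is a bound of \<open>a\<close> iff
  \<open>|a|\<^sub>\<phi> \<le> \<gamma> |e|\<^sub>\<phi>\<close> for all \<open>\<phi>\<close> in \<open>M\<close> (\<open>is_bound_iff\<close>).  Hence the bounded elements form a
  subspace on which the least bound is a norm, definite because \<open>M\<close> is sufficient.

  Condition (C) provides the weak products: in the GNS space of \<open>\<phi>\<close> the equality of operators in (C),
  evaluated at classes of elements of \<open>A\<^sub>0\<close>, is the identity \<open>\<phi>(bx, a*y) = \<phi>(cx, y)\<close>
  (\<open>weak_mult_if_weak_prod\<close>).  Submultiplicativity and the inequality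
  \<open>\<parallel>a\<parallel>\<^sup>2 \<le> \<parallel>a* \<diamond> a\<parallel>\<close> are Cauchy-Schwarz estimates of this identity.  Associativity requires
  a little more, because \<open>b(cx)\<close> has no meaning when \<open>cx\<close> is outside \<open>A\<^sub>0\<close>: there \<open>b\<close> has to be
  replaced by its continuous extension to the Hilbert space of \<open>\<phi>\<close>, and the extensions of \<open>b\<close> and \<open>b*\<close> have to be
  adjoint to each other (\<open>bounded_adjoint_pairing\<close>).

  Completeness is transported from \<open>A\<close>.  By the inequality \<open>|a|\<^sub>\<phi> \<le> \<parallel>a\<parallel> |e|\<^sub>\<phi>\<close>, and as
  \<open>|e|\<^sub>\<phi>\<close> is bounded on bounded families, a norm Cauchy sequence of bounded elements is Cauchy in
  \<open>A\<close>.  Its limit is also the norm limit, since the estimates at the unit survive pointwise limits in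
  \<open>|.|\<^sub>\<phi>\<close> (\<open>bounded_norm_limit\<close>).
\<close>

section \<open>Topologies given by seminorms\<close>

lemma openin_seminorm_ball:
  assumes "p \<in> P" "x \<in> V" "0 < r"
  shows "openin (seminorm_topology V diff P) {y \<in> V. p (diff y x) < r}"
  unfolding seminorm_topology_def using assms by (intro topology_generated_by_Basis) auto

text \<open>
  Every continuity claim reduces to this criterion, with \<open>g\<close> either a seminorm or the distance of a
  represented element to a fixed operator.
\<close>

lemma continuous_map_dominated_by_seminorm:
  fixes g :: "'v::ab_group_add \<Rightarrow> real"
  assumes p: "p \<in> P" "p 0 = 0" and g: "\<And>a b. \<bar>g a - g b\<bar> \<le> p (a - b)"
  shows "continuous_map (seminorm_topology UNIV (-) P) euclideanreal g"
  unfolding mtopology_is_euclidean[symmetric] Met_TC.continuous_map_to_metric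
proof (intro ballI allI impI)
  fix x and \<epsilon> :: real assume "0 < \<epsilon>"
  have "openin (seminorm_topology UNIV (-) P) {y \<in> UNIV. p (y - x) < \<epsilon>}"
    using p \<open>0 < \<epsilon>\<close> by (intro openin_seminorm_ball) auto
  moreover have "g y \<in> Met_TC.mball (g x) \<epsilon>" if "p (y - x) < \<epsilon>" for y
    using le_less_trans[OF g that] by (simp add: dist_commute dist_real_def)
  ultimately show "\<exists>U. openin (seminorm_topology UNIV (-) P) U \<and> x \<in> U \<and> (\<forall>y\<in>U. g y \<in> Met_TC.mball (g x) \<epsilon>)"
    using p \<open>0 < \<epsilon>\<close> by (intro exI[of _ "{y \<in> UNIV. p (y - x) < \<epsilon>}"]) simp
qed

text \<open>
  Completeness is a condition on filters; for a sequence it is applied to the filter of its tails.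
\<close>

lemma seminorm_complete_sequential_limit:
  fixes s :: "nat \<Rightarrow> 'v::ab_group_add"
  assumes complete: "seminorm_complete UNIV (-) P"
    and cauchy: "\<And>p r. p \<in> P \<Longrightarrow> 0 < r \<Longrightarrow> \<exists>N. \<forall>m\<ge>N. \<forall>n\<ge>N. p (s m - s n) < r"
    and zero: "\<And>p. p \<in> P \<Longrightarrow> p 0 = 0"
  shows "\<exists>x. \<forall>p\<in>P. \<forall>r>0. \<exists>N. \<forall>n\<ge>N. p (s n - x) < r"
proof -
  let ?F = "filtermap s sequentially"
  have "seminorm_cauchy UNIV (-) P ?F"
    unfolding seminorm_cauchy_def
  proof (intro conjI ballI allI impI)
    fix p and r :: real assume "p \<in> P" "0 < r"
    with cauchy obtain N where "\<forall>m\<ge>N. \<forall>n\<ge>N. p (s m - s n) < r" by blast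
    then show "\<exists>S\<subseteq>UNIV. eventually (\<lambda>x. x \<in> S) ?F \<and> (\<forall>x\<in>S. \<forall>y\<in>S. p (y - x) < r)"
      by (intro exI[of _ "s ` {N..}"]) (auto simp: eventually_filtermap eventually_sequentially)
  qed (auto simp: filtermap_bot_iff)
  with complete obtain x where x: "limitin (seminorm_topology UNIV (-) P) (\<lambda>y. y) x ?F"
    by (auto simp: seminorm_complete_def)
  have "\<exists>N. \<forall>n\<ge>N. p (s n - x) < r" if "p \<in> P" "0 < r" for p r
  proof -
    have "eventually (\<lambda>y. y \<in> {y \<in> UNIV. p (y - x) < r}) ?F"
      using x openin_seminorm_ball[of p P x UNIV r "(-)"] that zero[of p]
      by (auto simp: limitin_def dest!: spec[of _ "{y. p (y - x) < r}"])
    then show ?thesis by (simp add: eventually_filtermap eventually_sequentially)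
  qed
  then show ?thesis by blast
qed


section \<open>Operators with densely defined adjoint\<close>

context inner_product_space
begin

lemma inner_diff_left:
  assumes "\<xi> \<in> hcarrier H" "\<eta> \<in> hcarrier H" "\<zeta> \<in> hcarrier H"
  shows "hinner H (\<xi> - \<eta>) \<zeta> = hinner H \<xi> \<zeta> - hinner H \<eta> \<zeta>"
  using inner_add[OF carrier_diff[OF assms(1,2)] assms(2,3)] by simp

lemma inner_diff_right:
  assumes "\<xi> \<in> hcarrier H" "\<eta> \<in> hcarrier H" "\<zeta> \<in> hcarrier H"
  shows "hinner H \<zeta> (\<xi> - \<eta>) = hinner H \<zeta> \<xi> - hinner H \<zeta> \<eta>"
  using assms inner_diff_left[OF assms] inner_cnj carrier_diff complex_cnj_diff by metis

lemma hscale_minus_one: "hscale H (-1) \<xi> = - \<xi>"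
proof -
  interpret V: vector_space "hscale H" by (rule vs)
  show ?thesis by simp
qed

lemma hnorm_diff_commute: "\<xi> \<in> hcarrier H \<Longrightarrow> \<eta> \<in> hcarrier H \<Longrightarrow> hnorm H (\<xi> - \<eta>) = hnorm H (\<eta> - \<xi>)"
  using hnorm_scale[OF carrier_diff, of \<xi> \<eta> "-1"] by (simp add: hscale_minus_one)

lemma hnorm_reverse_triangle:
  assumes "\<xi> \<in> hcarrier H" "\<eta> \<in> hcarrier H"
  shows "\<bar>hnorm H \<xi> - hnorm H \<eta>\<bar> \<le> hnorm H (\<xi> - \<eta>)"
  using hnorm_triangle[OF carrier_diff[OF assms] assms(2)]
    hnorm_triangle[OF carrier_diff[OF assms(2,1)] assms(1)] hnorm_diff_commute[OF assms] by simp

lemma closure_of_approx: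
  assumes "\<xi> \<in> htop H closure_of D" "0 < \<epsilon>"
  obtains \<eta> where "\<eta> \<in> D" "\<eta> \<in> hcarrier H" "hnorm H (\<xi> - \<eta>) < \<epsilon>"
proof -
  interpret M: Metric_space "hcarrier H" "hdist H" by (rule Metric_space_hdist)
  obtain \<eta> where "\<eta> \<in> D" "\<eta> \<in> M.mball \<xi> \<epsilon>"
    using assms by (auto simp: htop_def M.metric_closure_of)
  moreover from this have "\<xi> \<in> hcarrier H" "\<eta> \<in> hcarrier H" "hdist H \<xi> \<eta> < \<epsilon>" by simp_all
  ultimately show ?thesis by (intro that) (simp_all add: hdist_def norm_dist_def)
qed

text \<open>
  The difference \<open>\<delta>\<close> of the two vectors is orthogonal to vectors \<open>\<eta>\<close> of \<open>D\<close> arbitrarily close to it, and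
  \<open>\<langle>\<delta>|\<delta>\<rangle> = \<langle>\<delta> - \<eta>|\<delta>\<rangle>\<close> is then arbitrarily small.
\<close>

lemma eq_if_inner_eq_on_dense:
  assumes dense: "htop H closure_of D = hcarrier H"
    and \<zeta>: "\<zeta> \<in> hcarrier H" "\<zeta>' \<in> hcarrier H"
    and eq: "\<And>\<eta>. \<eta> \<in> D \<Longrightarrow> \<eta> \<in> hcarrier H \<Longrightarrow> hinner H \<eta> \<zeta> = hinner H \<eta> \<zeta>'"
  shows "\<zeta> = \<zeta>'"
proof -
  define \<delta> where "\<delta> = \<zeta> - \<zeta>'"
  have \<delta>: "\<delta> \<in> hcarrier H" using \<zeta> by (simp add: \<delta>_def carrier_diff)
  have sq: "Re (hinner H \<delta> \<delta>) = (hnorm H \<delta>)\<^sup>2"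
    using inner_nonneg[OF \<delta>] by (simp add: hnorm_def form_norm_def)
  have "hnorm H \<delta> \<le> 0 + \<epsilon>" if \<epsilon>: "0 < \<epsilon>" for \<epsilon>
  proof -
    obtain \<eta> where \<eta>: "\<eta> \<in> D" "\<eta> \<in> hcarrier H" "hnorm H (\<delta> - \<eta>) < \<epsilon>"
      using closure_of_approx[of \<delta> D \<epsilon>] dense \<delta> \<epsilon> by auto
    have "hinner H \<eta> \<delta> = 0" using eq \<eta> \<zeta> by (simp add: \<delta>_def inner_diff_right)
    then have "hinner H \<delta> \<delta> = hinner H (\<delta> - \<eta>) \<delta>" using \<delta> \<eta> by (simp add: inner_diff_left)
    then have "(hnorm H \<delta>)\<^sup>2 \<le> hnorm H (\<delta> - \<eta>) * hnorm H \<delta>"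
      using inner_cauchy_schwarz[OF carrier_diff[OF \<delta> \<eta>(2)] \<delta>] complex_Re_le_cmod[of "hinner H \<delta> \<delta>"] sq
      by simp
    also have "\<dots> \<le> \<epsilon> * hnorm H \<delta>" using \<eta> \<delta> hnorm_nonneg by (intro mult_right_mono) auto
    finally show ?thesis
      using hnorm_nonneg[OF \<delta>] \<epsilon> by (cases "hnorm H \<delta> = 0") (auto simp: power2_eq_square)
  qed
  then have "hnorm H \<delta> = 0" using hnorm_nonneg[OF \<delta>] field_le_epsilon[of "hnorm H \<delta>" 0] by force
  then show ?thesis using hnorm_eq_0_iff[OF \<delta>] by (simp add: \<delta>_def)
qed

lemma op_adjD:
  assumes "(\<eta>, \<zeta>) \<in> op_adj H X"
  shows "\<eta> \<in> hcarrier H" "\<zeta> \<in> hcarrier H" "(\<xi>, \<xi>') \<in> X \<Longrightarrow> hinner H \<xi>' \<eta> = hinner H \<xi> \<zeta>"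
  using assms by (auto simp: op_adj_def)

lemma single_valued_op_adj:
  assumes "Domain X \<subseteq> hcarrier H" "htop H closure_of Domain X = hcarrier H"
  shows "single_valued (op_adj H X)"
proof (rule single_valuedI)
  fix \<eta> \<zeta> \<zeta>' assume adj: "(\<eta>, \<zeta>) \<in> op_adj H X" "(\<eta>, \<zeta>') \<in> op_adj H X"
  show "\<zeta> = \<zeta>'"
  proof (rule eq_if_inner_eq_on_dense[OF assms(2)])
    fix \<xi> assume "\<xi> \<in> Domain X"
    then obtain \<xi>' where "(\<xi>, \<xi>') \<in> X" by blast
    then show "hinner H \<xi> \<zeta> = hinner H \<xi> \<zeta>'" using op_adjD(3)[OF adj(1)] op_adjD(3)[OF adj(2)] by simp
  qed (use op_adjD(2) adj in blast)+
qed

lemma op_closure_approx: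
  assumes "(\<xi>, \<xi>') \<in> op_closure H X" "0 < \<epsilon>"
  obtains \<eta> \<eta>' where "(\<eta>, \<eta>') \<in> X" "\<eta> \<in> hcarrier H" "\<eta>' \<in> hcarrier H"
    "hnorm H (\<xi> - \<eta>) < \<epsilon>" "hnorm H (\<xi>' - \<eta>') < \<epsilon>"
proof -
  interpret M: Metric_space "hcarrier H" "hdist H" by (rule Metric_space_hdist)
  let ?T = "prod_topology M.mtopology M.mtopology"
  have cl: "(\<xi>, \<xi>') \<in> ?T closure_of X" using assms(1) by (simp add: op_closure_def htop_def)
  have "openin ?T (M.mball \<xi> \<epsilon> \<times> M.mball \<xi>' \<epsilon>)"
    by (simp add: openin_prod_Times_iff)
  moreover have "(\<xi>, \<xi>') \<in> M.mball \<xi> \<epsilon> \<times> M.mball \<xi>' \<epsilon>"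
    using cl assms(2) by (auto dest!: in_closure_of[THEN iffD1])
  ultimately have "\<exists>z. z \<in> X \<and> z \<in> M.mball \<xi> \<epsilon> \<times> M.mball \<xi>' \<epsilon>"
    using in_closure_of[THEN iffD1, OF cl] by meson
  then obtain \<eta> \<eta>' where "(\<eta>, \<eta>') \<in> X" "\<eta> \<in> M.mball \<xi> \<epsilon>" "\<eta>' \<in> M.mball \<xi>' \<epsilon>"
    by auto
  moreover from this have "\<xi> \<in> hcarrier H" "\<eta> \<in> hcarrier H" "\<xi>' \<in> hcarrier H" "\<eta>' \<in> hcarrier H"
    "hdist H \<xi> \<eta> < \<epsilon>" "hdist H \<xi>' \<eta>' < \<epsilon>" by simp_all
  ultimately show ?thesis by (intro that) (simp_all add: hdist_def norm_dist_def)
qed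

lemma op_closure_carrier: "op_closure H X \<subseteq> hcarrier H \<times> hcarrier H"
proof -
  interpret M: Metric_space "hcarrier H" "hdist H" by (rule Metric_space_hdist)
  show ?thesis
    using closure_of_subset_topspace[of "prod_topology M.mtopology M.mtopology" X]
    by (simp add: op_closure_def htop_def)
qed

text \<open>
  The relation \<open>\<langle>\<xi>'|\<eta>\<rangle> = \<langle>\<xi>|\<zeta>\<rangle>\<close> is continuous in \<open>(\<xi>, \<xi>')\<close>, so it extends from the graph
  to its closure.
\<close>

lemma op_adj_op_closure: "op_adj H X \<subseteq> op_adj H (op_closure H X)"
proof
  fix z assume "z \<in> op_adj H X"
  then obtain \<eta> \<zeta> where z: "z = (\<eta>, \<zeta>)" "(\<eta>, \<zeta>) \<in> op_adj H X" by (cases z) auto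
  note adj = op_adjD(3)[OF z(2)] and z = z(1) op_adjD(1,2)[OF z(2)]
  have "hinner H \<xi>' \<eta> = hinner H \<xi> \<zeta>" if X: "(\<xi>, \<xi>') \<in> op_closure H X" for \<xi> \<xi>'
  proof -
    have car: "\<xi> \<in> hcarrier H" "\<xi>' \<in> hcarrier H" using X op_closure_carrier by auto
    \<comment> \<open>The summand 1 only makes it possible to divide by \<open>K\<close>.\<close>
    define K where "K = hnorm H \<eta> + hnorm H \<zeta> + 1"
    have K: "0 < K" using z hnorm_nonneg by (simp add: K_def add_nonneg_pos)
    have "cmod (hinner H \<xi>' \<eta> - hinner H \<xi> \<zeta>) \<le> 0 + \<epsilon>" if \<epsilon>: "0 < \<epsilon>" for \<epsilon>
    proof -
      obtain \<theta> \<theta>' where t: "(\<theta>, \<theta>') \<in> X" "\<theta> \<in> hcarrier H" "\<theta>' \<in> hcarrier H"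
        "hnorm H (\<xi> - \<theta>) < \<epsilon> / K" "hnorm H (\<xi>' - \<theta>') < \<epsilon> / K"
        using op_closure_approx[OF X, of "\<epsilon> / K"] \<epsilon> K by auto
      have "hinner H \<xi>' \<eta> - hinner H \<xi> \<zeta> = hinner H (\<xi>' - \<theta>') \<eta> - hinner H (\<xi> - \<theta>) \<zeta>"
        using t car z adj[OF t(1)] by (simp add: inner_diff_left)
      then have "cmod (hinner H \<xi>' \<eta> - hinner H \<xi> \<zeta>)
          \<le> hnorm H (\<xi>' - \<theta>') * hnorm H \<eta> + hnorm H (\<xi> - \<theta>) * hnorm H \<zeta>"
        using inner_cauchy_schwarz[OF carrier_diff[OF car(2) t(3)] z(2)]
          inner_cauchy_schwarz[OF carrier_diff[OF car(1) t(2)] z(3)]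
          norm_triangle_ineq4[of "hinner H (\<xi>' - \<theta>') \<eta>" "hinner H (\<xi> - \<theta>) \<zeta>"] by simp
      also have "\<dots> \<le> \<epsilon> / K * hnorm H \<eta> + \<epsilon> / K * hnorm H \<zeta>"
        using t z hnorm_nonneg by (intro add_mono mult_right_mono) auto
      also have "\<dots> \<le> \<epsilon> / K * K"
        using \<epsilon> K unfolding distrib_left[symmetric] by (intro mult_left_mono) (auto simp: K_def)
      also have "\<dots> = 0 + \<epsilon>" using K by simp
      finally show ?thesis .
    qed
    then have "cmod (hinner H \<xi>' \<eta> - hinner H \<xi> \<zeta>) \<le> 0" by (rule field_le_epsilon)
    then show ?thesis by simp
  qed
  then show "z \<in> op_adj H (op_closure H X)" using z by (auto simp: op_adj_def)
qed

text \<open>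
  All values of the closure at one vector have the same inner products with the domain of the adjoint,
  which is dense.
\<close>

lemma closable_if_densely_defined_adj:
  assumes "htop H closure_of Domain (op_adj H X) = hcarrier H"
  shows "single_valued (op_closure H X)"
proof (rule single_valuedI)
  fix \<xi> \<zeta> \<zeta>' assume z: "(\<xi>, \<zeta>) \<in> op_closure H X" "(\<xi>, \<zeta>') \<in> op_closure H X"
  have car: "\<xi> \<in> hcarrier H" "\<zeta> \<in> hcarrier H" "\<zeta>' \<in> hcarrier H" using z op_closure_carrier by auto
  have "hinner H \<eta> \<zeta> = hinner H \<eta> \<zeta>'" if \<eta>: "\<eta> \<in> Domain (op_adj H X)" "\<eta> \<in> hcarrier H" for \<eta>
  proof -
    obtain \<theta> where "(\<eta>, \<theta>) \<in> op_adj H (op_closure H X)" using \<eta> op_adj_op_closure by blast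
    then have "hinner H \<zeta> \<eta> = hinner H \<zeta>' \<eta>" using op_adjD(3)[of \<eta> \<theta>] z by metis
    then show ?thesis using inner_cnj[OF car(2) \<eta>(2)] inner_cnj[OF car(3) \<eta>(2)] by simp
  qed
  then show "\<zeta> = \<zeta>'" using assms car by (intro eq_if_inner_eq_on_dense)
qed

lemma op_diff_iff: "(\<theta>, \<theta>') \<in> op_diff H X Y \<longleftrightarrow> (\<exists>\<eta> \<zeta>. \<theta>' = \<eta> - \<zeta> \<and> (\<theta>, \<eta>) \<in> X \<and> (\<theta>, \<zeta>) \<in> Y)"
  (is "_ \<longleftrightarrow> ?R")
proof
  assume "(\<theta>, \<theta>') \<in> op_diff H X Y"
  then obtain \<eta> \<zeta> where "\<theta>' = \<eta> + hscale H (-1) \<zeta>" "(\<theta>, \<eta>) \<in> X" "(\<theta>, \<zeta>) \<in> Y"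
    unfolding op_diff_def op_add_def op_scale_def by blast
  then show ?R by (intro exI[of _ \<eta>] exI[of _ \<zeta>]) (simp add: hscale_minus_one)
next
  assume ?R
  then obtain \<eta> \<zeta> where "\<theta>' = \<eta> + hscale H (-1) \<zeta>" "(\<theta>, \<eta>) \<in> X" "(\<theta>, \<zeta>) \<in> Y"
    by (auto simp: hscale_minus_one)
  then show "(\<theta>, \<theta>') \<in> op_diff H X Y"
    unfolding op_diff_def op_add_def op_scale_def by blast
qed

lemma op_val_eqI: "single_valued X \<Longrightarrow> (\<xi>, \<eta>) \<in> X \<Longrightarrow> op_val X \<xi> = \<eta>"
  unfolding op_val_def by (rule the_equality) (auto dest: single_valuedD)

context
  fixes D assumes dense: "dense_subspace H D"
begin

lemma Ldag_op_val:
  assumes "X \<in> Ldag H D" "\<xi> \<in> D"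
  shows "(\<xi>, op_val X \<xi>) \<in> X" "op_val X \<xi> \<in> hcarrier H"
proof -
  have X: "single_valued X" "X \<subseteq> hcarrier H \<times> hcarrier H" "Domain X = D"
    using assms by (auto simp: Ldag_def linear_op_def)
  with assms obtain \<eta> where "(\<xi>, \<eta>) \<in> X" by blast
  with X show "(\<xi>, op_val X \<xi>) \<in> X" "op_val X \<xi> \<in> hcarrier H" by (auto simp: op_val_eqI)
qed

lemma Ldag_op_dag_val:
  assumes "X \<in> Ldag H D" "\<xi> \<in> D"
  shows "(\<xi>, op_val (op_dag H X) \<xi>) \<in> op_adj H X" "op_val (op_dag H X) \<xi> \<in> hcarrier H"
proof -
  have X: "Domain X = D" "D \<subseteq> Domain (op_adj H X)" using assms by (auto simp: Ldag_def)
  have "single_valued (op_adj H X)"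
    using X dense by (intro single_valued_op_adj) (auto simp: dense_subspace_def)
  then have sv: "single_valued (op_dag H X)" by (auto simp: op_dag_def single_valued_def)
  obtain \<eta> where \<eta>: "(\<xi>, \<eta>) \<in> op_adj H X" using X assms by blast
  then have "(\<xi>, \<eta>) \<in> op_dag H X" using X assms by (simp add: op_dag_def)
  then have "op_val (op_dag H X) \<xi> = \<eta>" by (rule op_val_eqI[OF sv])
  with \<eta> show "(\<xi>, op_val (op_dag H X) \<xi>) \<in> op_adj H X" "op_val (op_dag H X) \<xi> \<in> hcarrier H"
    by (auto simp: op_adj_def)
qed

text \<open>
  The values of \<open>op_dag\<close> are determined by \<open>single_valued_op_adj\<close>, because the domain \<open>D\<close> of the
  difference is dense; hence it suffices to see that the difference of the two adjoints is a formal
  adjoint of the difference.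
\<close>

lemma op_val_op_diff:
  assumes X: "X \<in> Ldag H D" and Y: "Y \<in> Ldag H D" and \<xi>: "\<xi> \<in> D"
  shows "op_val (op_diff H X Y) \<xi> = op_val X \<xi> - op_val Y \<xi>"
    and "op_val (op_dag H (op_diff H X Y)) \<xi> = op_val (op_dag H X) \<xi> - op_val (op_dag H Y) \<xi>"
proof -
  have D: "D \<subseteq> hcarrier H" using dense by (simp add: dense_subspace_def)
  have svX: "single_valued X" and svY: "single_valued Y" and dom: "Domain X = D" "Domain Y = D"
    and car: "X \<subseteq> hcarrier H \<times> hcarrier H" "Y \<subseteq> hcarrier H \<times> hcarrier H"
    using X Y by (auto simp: Ldag_def linear_op_def)
  have diff: "(\<theta>, \<theta>') \<in> op_diff H X Y \<longleftrightarrow> (\<exists>\<eta> \<zeta>. \<theta>' = \<eta> - \<zeta> \<and> (\<theta>, \<eta>) \<in> X \<and> (\<theta>, \<zeta>) \<in> Y)" for \<theta> \<theta>'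
    using op_diff_iff by blast
  have "single_valued (op_diff H X Y)"
    by (intro single_valuedI) (metis diff svX svY single_valuedD)
  moreover have "(\<xi>, op_val X \<xi> - op_val Y \<xi>) \<in> op_diff H X Y"
    using Ldag_op_val[OF X \<xi>] Ldag_op_val[OF Y \<xi>] diff by blast
  ultimately show "op_val (op_diff H X Y) \<xi> = op_val X \<xi> - op_val Y \<xi>" by (rule op_val_eqI)
  have Ddiff: "Domain (op_diff H X Y) = D" using dom diff by blast
  have "single_valued (op_adj H (op_diff H X Y))"
    using Ddiff dense by (intro single_valued_op_adj) (auto simp: dense_subspace_def)
  then have "single_valued (op_dag H (op_diff H X Y))" by (auto simp: op_dag_def single_valued_def)
  moreover have "(\<xi>, op_val (op_dag H X) \<xi> - op_val (op_dag H Y) \<xi>) \<in> op_adj H (op_diff H X Y)"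
  proof -
    note x = Ldag_op_dag_val[OF X \<xi>] and y = Ldag_op_dag_val[OF Y \<xi>]
    have "hinner H \<theta>' \<xi> = hinner H \<theta> (op_val (op_dag H X) \<xi> - op_val (op_dag H Y) \<xi>)"
      if \<theta>: "(\<theta>, \<theta>') \<in> op_diff H X Y" for \<theta> \<theta>'
    proof -
      obtain \<eta> \<zeta> where t: "\<theta>' = \<eta> - \<zeta>" "(\<theta>, \<eta>) \<in> X" "(\<theta>, \<zeta>) \<in> Y" using \<theta> unfolding diff by blast
      then have "hinner H \<eta> \<xi> = hinner H \<theta> (op_val (op_dag H X) \<xi>)"
        "hinner H \<zeta> \<xi> = hinner H \<theta> (op_val (op_dag H Y) \<xi>)"
        using op_adjD(3)[OF x(1)] op_adjD(3)[OF y(1)] by blast+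
      then show ?thesis
        using t car D \<xi> x(2) y(2) by (auto simp: inner_diff_left inner_diff_right subset_iff)
    qed
    then show ?thesis using D \<xi> x y by (auto simp: op_adj_def carrier_diff)
  qed
  ultimately show "op_val (op_dag H (op_diff H X Y)) \<xi> = op_val (op_dag H X) \<xi> - op_val (op_dag H Y) \<xi>"
    using \<xi> Ddiff by (intro op_val_eqI) (auto simp: op_dag_def)
qed

end

end


section \<open>Forms for which the core is dense\<close>

context quasi_star_algebra
begin

lemma mul_left_add: "x \<in> qcore Q \<Longrightarrow> qmul Q (a + b) x = qmul Q a x + qmul Q b x"
  and mul_left_scale: "x \<in> qcore Q \<Longrightarrow> qmul Q (qscale Q c a) x = qscale Q c (qmul Q a x)"
proof -
  interpret V: vector_space "qscale Q" by (rule vs)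
  assume x: "x \<in> qcore Q"
  interpret L: Vector_Spaces.linear "qscale Q" "qscale Q" "\<lambda>a. qmul Q a x" by (rule right_linear[OF x])
  show "qmul Q (a + b) x = qmul Q a x + qmul Q b x" "qmul Q (qscale Q c a) x = qscale Q c (qmul Q a x)"
    by (rule L.add L.scale)+
qed

lemma core_diff: "x \<in> qcore Q \<Longrightarrow> y \<in> qcore Q \<Longrightarrow> x - y \<in> qcore Q"
  using module.subspace_diff[OF _ core_subspace] vs unfolding vector_space_def module_def by blast

lemma mul_right_diff:
  "x \<in> qcore Q \<Longrightarrow> y \<in> qcore Q \<Longrightarrow> qmul Q a (x - y) = qmul Q a x - qmul Q a y"
  using right_add[of "x - y" y a] core_diff[of x y] by simp

lemma star_diff: "qstar Q (a - b) = qstar Q a - qstar Q b"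
  using star_add[of "a - b" b] by simp

lemma star_zero: "qstar Q 0 = 0"
  using star_diff[of 0 0] by simp

end

text \<open>
  The estimates below are made for one form at a time; this locale collects what a single member of
  \<open>M\<close> satisfies.
\<close>

locale core_dense_form = quasi_star_algebra Q for Q :: "'a::ab_group_add quasi" +
  fixes \<phi> :: "'a form"
  assumes I_form: "\<phi> \<in> I_forms Q"
begin

lemma sesq: "sesquilinear (qscale Q) \<phi>"
  and pos: "positive_form \<phi>"
  and form_mul: "x \<in> qcore Q \<Longrightarrow> y \<in> qcore Q \<Longrightarrow> \<phi> (qmul Q a x) y = \<phi> x (qmul Q (qstar Q a) y)"
  and core_dense: "htop (gns_space \<phi>) closure_of (gns_map \<phi> ` qcore Q) = hcarrier (gns_space \<phi>)"
  using I_form by (auto simp: I_forms_def Q_forms_def)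

sublocale gns: inner_product_space "gns_space \<phi>"
  by (rule gns_inner_product_space[OF vs sesq pos])

lemmas form_simps = sesqD[OF vs sesq]
lemmas herm = form_herm[OF vs sesq pos]
lemmas cauchy_schwarz = form_cs[OF vs sesq pos]
lemmas norm_triangle = form_triangle[OF vs sesq pos]
lemmas norm_nonneg = form_norm_nonneg[OF vs sesq pos]
lemmas norm_minus = form_norm_minus[OF vs sesq pos]
lemmas norm_zero = form_norm_zero[OF vs sesq pos]
lemmas norm_scale = form_norm_scale[OF vs sesq pos]
lemmas norm_sq = form_norm_sq[OF vs sesq pos]
lemmas map_carrier = gns_map_carrier[OF vs sesq pos]
lemmas map_inner = gns_map_inner[OF vs sesq pos]

lemma map_diff: "gns_map \<phi> a - gns_map \<phi> b = gns_map \<phi> (a - b)"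
  by (simp add: gns_map_def fun_eq_iff form_simps)

lemma map_norm: "hnorm (gns_space \<phi>) (gns_map \<phi> a) = form_norm \<phi> a"
  by (simp add: hnorm_def form_norm_def map_inner)

lemma core_sequence:
  obtains y where "\<And>n. y n \<in> qcore Q" "(\<lambda>n. form_norm \<phi> (y n - a)) \<longlonglongrightarrow> 0"
proof -
  have "\<exists>x\<in>qcore Q. form_norm \<phi> (x - a) < inverse (real (Suc n))" for n
  proof -
    obtain f where f: "f \<in> gns_map \<phi> ` qcore Q" "hnorm (gns_space \<phi>) (gns_map \<phi> a - f) < inverse (real (Suc n))"
    proof (rule gns.closure_of_approx)
      show "gns_map \<phi> a \<in> htop (gns_space \<phi>) closure_of (gns_map \<phi> ` qcore Q)"
        using core_dense map_carrier by simp
      show "0 < inverse (real (Suc n))" by simp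
    qed blast
    then obtain x where "x \<in> qcore Q" "form_norm \<phi> (a - x) < inverse (real (Suc n))"
      by (auto simp: map_diff map_norm simp del: of_nat_Suc)
    then show ?thesis using norm_minus[of a x] by metis
  qed
  then obtain y where y: "\<And>n. y n \<in> qcore Q" "\<And>n. form_norm \<phi> (y n - a) < inverse (real (Suc n))"
    by metis
  have "(\<lambda>n. form_norm \<phi> (y n - a)) \<longlonglongrightarrow> 0"
    by (rule tendsto_sandwich[OF _ _ tendsto_const LIMSEQ_inverse_real_of_nat])
       (use y(2) norm_nonneg in \<open>auto intro!: always_eventually less_imp_le simp del: of_nat_Suc\<close>)
  then show ?thesis using y(1) that by blast
qed

lemma form_tendsto_right:
  assumes "(\<lambda>n. form_norm \<phi> (y n - a)) \<longlonglongrightarrow> 0"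
  shows "(\<lambda>n. \<phi> b (y n)) \<longlonglongrightarrow> \<phi> b a"
proof -
  have "(\<lambda>n. \<phi> b (y n) - \<phi> b a) \<longlonglongrightarrow> 0"
  proof (rule Lim_null_comparison[OF always_eventually[OF allI]])
    show "cmod (\<phi> b (y n) - \<phi> b a) \<le> form_norm \<phi> b * form_norm \<phi> (y n - a)" for n
      using cauchy_schwarz[of b "y n - a"] by (simp add: form_simps)
    show "(\<lambda>n. form_norm \<phi> b * form_norm \<phi> (y n - a)) \<longlonglongrightarrow> 0"
      using tendsto_mult_left[OF assms, of "form_norm \<phi> b"] by simp
  qed
  then show ?thesis by (rule LIM_zero_cancel)
qed

lemma norm_tendsto:
  assumes "(\<lambda>n. form_norm \<phi> (y n - a)) \<longlonglongrightarrow> 0"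
  shows "(\<lambda>n. form_norm \<phi> (y n)) \<longlonglongrightarrow> form_norm \<phi> a"
proof -
  have "(\<lambda>n. form_norm \<phi> (y n) - form_norm \<phi> a) \<longlonglongrightarrow> 0"
  proof (rule Lim_null_comparison[OF always_eventually[OF allI] assms])
    show "norm (form_norm \<phi> (y n) - form_norm \<phi> a) \<le> form_norm \<phi> (y n - a)" for n
      using norm_triangle[of "y n - a" a] norm_triangle[of "a - y n" "y n"] norm_minus[of a "y n"]
      by (simp add: abs_le_iff)
  qed
  then show ?thesis by (rule LIM_zero_cancel)
qed

text \<open>
  By density, the functional \<open>\<phi>(a, .)\<close> may be tested on the core only, and its norm is \<open>|a|\<^sub>\<phi>\<close>.
\<close>

lemma norm_le_if_core_bound:
  assumes bound: "\<And>y. y \<in> qcore Q \<Longrightarrow> cmod (\<phi> a y) \<le> K * form_norm \<phi> y" and K: "0 \<le> K"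
  shows "form_norm \<phi> a \<le> K"
proof -
  obtain y where y: "\<And>n. y n \<in> qcore Q" "(\<lambda>n. form_norm \<phi> (y n - a)) \<longlonglongrightarrow> 0"
    using core_sequence by blast
  have "cmod (\<phi> a a) \<le> K * form_norm \<phi> a"
    by (rule LIMSEQ_le[OF tendsto_norm[OF form_tendsto_right[OF y(2)]] tendsto_mult_left[OF norm_tendsto[OF y(2)]]])
       (use bound y(1) in blast)
  then have "form_norm \<phi> a * form_norm \<phi> a \<le> K * form_norm \<phi> a"
    using norm_sq[of a] by (simp add: power2_eq_square norm_mult norm_nonneg)
  then show ?thesis using K norm_nonneg[of a] by (cases "form_norm \<phi> a = 0") auto
qed

lemma form_eqI:
  assumes "\<And>y. y \<in> qcore Q \<Longrightarrow> \<phi> a y = \<phi> b y"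
  shows "form_norm \<phi> (a - b) = 0"
  using norm_le_if_core_bound[of "a - b" 0] assms norm_nonneg[of "a - b"] by (auto simp: form_simps)

text \<open>
  Here \<open>v\<close> plays the role of \<open>bz\<close> and \<open>s\<close> that of \<open>b*u\<close>, although \<open>z\<close> and \<open>u\<close> need not be in the
  core and these products need not exist.  With \<open>y\<^sub>n\<close> in the core tending to \<open>u\<close>, the bound on \<open>b\<close> makes
  \<open>b*y\<^sub>n\<close> tend to \<open>s\<close>, and the assertion is the limit of \<open>\<phi>(v, y\<^sub>n) = \<phi>(z, b*y\<^sub>n)\<close>.
\<close>

lemma bounded_adjoint_pairing:
  assumes bound: "\<And>x. x \<in> qcore Q \<Longrightarrow> form_norm \<phi> (qmul Q b x) \<le> K * form_norm \<phi> x"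
    and v: "\<And>w. w \<in> qcore Q \<Longrightarrow> \<phi> v w = \<phi> z (qmul Q (qstar Q b) w)"
    and s: "\<And>w. w \<in> qcore Q \<Longrightarrow> \<phi> s w = \<phi> u (qmul Q b w)"
  shows "\<phi> v u = \<phi> z s"
proof -
  obtain y where y: "\<And>n. y n \<in> qcore Q" "(\<lambda>n. form_norm \<phi> (y n - u)) \<longlonglongrightarrow> 0"
    using core_sequence by blast
  have est: "form_norm \<phi> (qmul Q (qstar Q b) (y n) - s) \<le> \<bar>K\<bar> * form_norm \<phi> (y n - u)" for n
  proof -
    have "cmod (\<phi> (qmul Q (qstar Q b) (y n) - s) w) \<le> (\<bar>K\<bar> * form_norm \<phi> (y n - u)) * form_norm \<phi> w"
      if w: "w \<in> qcore Q" for w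
    proof -
      have "\<phi> (qmul Q (qstar Q b) (y n) - s) w = \<phi> (y n - u) (qmul Q b w)"
        using form_mul[OF y(1) w, of "qstar Q b"] s[OF w] by (simp add: form_simps star_star)
      also have "cmod \<dots> \<le> form_norm \<phi> (y n - u) * form_norm \<phi> (qmul Q b w)" by (rule cauchy_schwarz)
      also have "\<dots> \<le> form_norm \<phi> (y n - u) * (\<bar>K\<bar> * form_norm \<phi> w)"
        using order_trans[OF bound[OF w] mult_right_mono[OF abs_ge_self norm_nonneg]] norm_nonneg
        by (intro mult_left_mono) auto
      finally show ?thesis by (simp add: mult_ac)
    qed
    from norm_le_if_core_bound[OF this] norm_nonneg show ?thesis by auto
  qed
  have "(\<lambda>n. form_norm \<phi> (qmul Q (qstar Q b) (y n) - s)) \<longlonglongrightarrow> 0"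
    by (rule tendsto_sandwich[OF _ _ tendsto_const, where h = "\<lambda>n. \<bar>K\<bar> * form_norm \<phi> (y n - u)"])
       (use est norm_nonneg tendsto_mult_left[OF y(2), of "\<bar>K\<bar>"] in \<open>auto intro!: always_eventually\<close>)
  then have "(\<lambda>n. \<phi> z (qmul Q (qstar Q b) (y n))) \<longlonglongrightarrow> \<phi> z s" by (rule form_tendsto_right)
  then have "(\<lambda>n. \<phi> v (y n)) \<longlonglongrightarrow> \<phi> z s" using v y(1) by simp
  then show ?thesis using form_tendsto_right[OF y(2)] LIMSEQ_unique by blast
qed


section \<open>The GNS representation on the core\<close>

text \<open>
  This is the invariance \<open>\<phi>(ax, y) = \<phi>(x, a*y)\<close> of the form.  It makes the adjoint densely defined, so
  that the closure of the representing operator is again an operator.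
\<close>

lemma gns_rep0_adj: "gns_rep0 Q \<phi> (qstar Q a) \<subseteq> op_adj (gns_space \<phi>) (gns_rep0 Q \<phi> a)"
  by (auto simp: gns_rep0_def op_adj_def map_carrier map_inner form_mul)

lemma single_valued_gns_rep0_closure: "single_valued (op_closure (gns_space \<phi>) (gns_rep0 Q \<phi> a))"
proof (rule gns.closable_if_densely_defined_adj)
  let ?A = "Domain (op_adj (gns_space \<phi>) (gns_rep0 Q \<phi> a))"
  have "gns_map \<phi> ` qcore Q \<subseteq> ?A" using gns_rep0_adj[of a] by (auto simp: gns_rep0_def)
  then have "htop (gns_space \<phi>) closure_of (gns_map \<phi> ` qcore Q) \<subseteq> htop (gns_space \<phi>) closure_of ?A"
    by (rule closure_of_mono)
  moreover have "htop (gns_space \<phi>) closure_of ?A \<subseteq> hcarrier (gns_space \<phi>)"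
    using closure_of_subset_topspace[of "htop (gns_space \<phi>)" ?A] gns.Metric_space_hdist
    by (simp add: htop_def Metric_space.topspace_mtopology)
  ultimately show "htop (gns_space \<phi>) closure_of ?A = hcarrier (gns_space \<phi>)" using core_dense by simp
qed

lemma gns_rep0_subset_closure: "gns_rep0 Q \<phi> a \<subseteq> op_closure (gns_space \<phi>) (gns_rep0 Q \<phi> a)"
  unfolding op_closure_def
  by (rule closure_of_subset)
     (auto simp: htop_def Metric_space.topspace_mtopology[OF gns.Metric_space_hdist] gns_rep0_def map_carrier)

text \<open>
  The principal filter at a vector of the core converges to it; it is Cauchy for the graph seminorms
  because they vanish at \<open>0\<close>.
\<close>

lemma core_in_gns_domain:
  assumes x: "x \<in> qcore Q"
  shows "gns_map \<phi> x \<in> gns_domain Q \<phi>"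
proof -
  let ?F = "principal {gns_map \<phi> x}"
  let ?P = "insert (hnorm (gns_space \<phi>)) (range (\<lambda>a \<eta>. hnorm (gns_space \<phi>) (op_val (gns_rep0 Q \<phi> a) \<eta>)))"
  have zero: "0 \<in> qcore Q" using core_diff[OF x x] by simp
  have map0: "gns_map \<phi> 0 = 0" by (simp add: gns_map_def fun_eq_iff form_simps)
  have "op_val (gns_rep0 Q \<phi> a) 0 = 0" for a
  proof (rule gns.op_val_eqI)
    show "single_valued (gns_rep0 Q \<phi> a)"
      using single_valued_gns_rep0_closure gns_rep0_subset_closure single_valued_subset by metis
    have "qmul Q a 0 = 0" using mul_right_diff[OF zero zero, of a] by simp
    then show "(0, 0) \<in> gns_rep0 Q \<phi> a" using zero map0 by (auto simp: gns_rep0_def intro!: exI[of _ 0])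
  qed
  moreover have "hnorm (gns_space \<phi>) 0 = 0" using gns.hnorm_eq_0_iff[OF gns.carrier_0] by simp
  ultimately have "seminorm_cauchy (gns_map \<phi> ` qcore Q) (-) ?P ?F"
    unfolding seminorm_cauchy_def using x
    by (auto simp: eventually_principal principal_eq_bot_iff intro!: exI[of _ "{gns_map \<phi> x}"])
  moreover have "limitin (htop (gns_space \<phi>)) (\<lambda>\<eta>. \<eta>) (gns_map \<phi> x) ?F"
    using map_carrier by (auto simp: limitin_def eventually_principal htop_def
        Metric_space.topspace_mtopology[OF gns.Metric_space_hdist])
  ultimately show ?thesis unfolding gns_domain_def closure_domain_def by blast
qed

lemma gns_rep_core_iff:
  assumes x: "x \<in> qcore Q"
  shows "(gns_map \<phi> x, \<eta>) \<in> gns_rep Q \<phi> a \<longleftrightarrow> \<eta> = gns_map \<phi> (qmul Q a x)"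
proof -
  have "(gns_map \<phi> x, gns_map \<phi> (qmul Q a x)) \<in> op_closure (gns_space \<phi>) (gns_rep0 Q \<phi> a)"
    using gns_rep0_subset_closure x by (fastforce simp: gns_rep0_def)
  then show ?thesis
    using core_in_gns_domain[OF x] single_valued_gns_rep0_closure[of a] 
    by (auto simp: gns_rep_def closure_rep_def gns_domain_def dest: single_valuedD)
qed

lemma gns_rep_dag_core:
  assumes y: "y \<in> qcore Q"
  shows "(gns_map \<phi> y, gns_map \<phi> (qmul Q (qstar Q a) y)) \<in> op_dag (gns_space \<phi>) (gns_rep Q \<phi> a)"
proof -
  have "(gns_map \<phi> y, gns_map \<phi> (qmul Q (qstar Q a) y)) \<in> op_adj (gns_space \<phi>) (gns_rep0 Q \<phi> a)"
    using gns_rep0_adj[of a] y by (fastforce simp: gns_rep0_def)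
  then have "(gns_map \<phi> y, gns_map \<phi> (qmul Q (qstar Q a) y))
      \<in> op_adj (gns_space \<phi>) (op_closure (gns_space \<phi>) (gns_rep0 Q \<phi> a))"
    using gns.op_adj_op_closure by blast
  then have "(gns_map \<phi> y, gns_map \<phi> (qmul Q (qstar Q a) y)) \<in> op_adj (gns_space \<phi>) (gns_rep Q \<phi> a)"
    by (auto simp: op_adj_def gns_rep_def closure_rep_def)
  moreover have "gns_map \<phi> y \<in> Domain (gns_rep Q \<phi> a)" using gns_rep_core_iff[OF y] by blast
  ultimately show ?thesis by (simp add: op_dag_def)
qed

text \<open>
  The two operators are compared at the class of \<open>x\<close>: the product first moves it to the class of \<open>bx\<close>,
  and pairing with the vector \<open>y\<close> of the domain of \<open>\<pi>(a)\<^sup>\<dagger>\<close> produces \<open>a*y\<close>.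
\<close>

lemma weak_mult_if_weak_prod:
  assumes "weak_prod (gns_space \<phi>) (gns_rep Q \<phi> a) (gns_rep Q \<phi> b) = gns_rep Q \<phi> c"
    and x: "x \<in> qcore Q" and y: "y \<in> qcore Q"
  shows "\<phi> (qmul Q b x) (qmul Q (qstar Q a) y) = \<phi> (qmul Q c x) y"
proof -
  have "(gns_map \<phi> x, gns_map \<phi> (qmul Q c x)) \<in> weak_prod (gns_space \<phi>) (gns_rep Q \<phi> a) (gns_rep Q \<phi> b)"
    using assms gns_rep_core_iff by simp
  then have "(gns_map \<phi> (qmul Q b x), gns_map \<phi> (qmul Q c x))
      \<in> op_adj (gns_space \<phi>) (op_dag (gns_space \<phi>) (gns_rep Q \<phi> a))"
    using gns_rep_core_iff[OF x] by (auto simp: weak_prod_def)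
  from gns.op_adjD(3)[OF this gns_rep_dag_core[OF y]]
  have "\<phi> (qmul Q (qstar Q a) y) (qmul Q b x) = \<phi> y (qmul Q c x)" by (simp add: map_inner)
  then show ?thesis using herm by metis
qed

end


section \<open>The seminorms of a family of forms\<close>

lemma seminorm_on_zero: "seminorm_on sc p \<Longrightarrow> vector_space sc \<Longrightarrow> p 0 = 0"
proof -
  assume p: "seminorm_on sc p" and "vector_space sc"
  then interpret vector_space sc by simp
  have "p (sc 0 0) = cmod 0 * p 0" using p unfolding seminorm_on_def by blast
  then show ?thesis by simp
qed

lemma seminorm_on_reverse_triangle:
  assumes p: "seminorm_on sc p" and "vector_space sc"
  shows "\<bar>p a - p b\<bar> \<le> p (a - b)"
proof -
  interpret vector_space sc by fact
  have "p (sc (-1) (a - b)) = cmod (-1) * p (a - b)" using p unfolding seminorm_on_def by blast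
  then have "p (b - a) = p (a - b)" by simp
  moreover have "p ((a - b) + b) \<le> p (a - b) + p b" "p ((b - a) + a) \<le> p (b - a) + p a"
    using p unfolding seminorm_on_def by blast+
  ultimately show ?thesis by simp
qed

lemma family_seminorm_upper:
  assumes "bounded_family F" "\<phi> \<in> F"
  shows "form_norm \<phi> a \<le> family_seminorm F a"
proof -
  obtain K where "\<And>\<psi>. \<psi> \<in> F \<Longrightarrow> Re (\<psi> a a) \<le> K"
    using assms(1) by (fastforce simp: bounded_family_def bdd_above_def)
  then have "bdd_above ((\<lambda>\<psi>. form_norm \<psi> a) ` F)"
    by (intro bdd_aboveI[of _ "sqrt K"]) (auto simp: form_norm_def)
  then show ?thesis unfolding family_seminorm_def using assms(2) by (intro cSup_upper) auto
qed

lemma family_seminorm_least: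
  assumes "\<And>\<phi>. \<phi> \<in> F \<Longrightarrow> form_norm \<phi> a \<le> r" "0 \<le> r"
  shows "family_seminorm F a \<le> r"
  unfolding family_seminorm_def using assms by (intro cSup_least) auto

lemma bounded_family_singleton: "bounded_family {\<phi>}"
  by (simp add: bounded_family_def)

context core_dense_form
begin

lemma family_star_seminorm_singleton:
  "family_star_seminorm Q {\<phi>} a = max (form_norm \<phi> a) (form_norm \<phi> (qstar Q a))"
proof -
  have "family_seminorm {\<phi>} b = form_norm \<phi> b" for b
    using family_seminorm_upper[OF bounded_family_singleton, of \<phi> \<phi> b]
      family_seminorm_least[of "{\<phi>}" b "form_norm \<phi> b"] norm_nonneg by force
  then show ?thesis by (simp add: family_star_seminorm_def)
qed

lemma seminorm_on_family_star_seminorm_singleton: "seminorm_on (qscale Q) (family_star_seminorm Q {\<phi>})"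
  unfolding seminorm_on_def family_star_seminorm_singleton
proof (intro conjI allI)
  fix a b c
  show "0 \<le> max (form_norm \<phi> a) (form_norm \<phi> (qstar Q a))" using norm_nonneg[of a] by simp
  show "max (form_norm \<phi> (a + b)) (form_norm \<phi> (qstar Q (a + b)))
    \<le> max (form_norm \<phi> a) (form_norm \<phi> (qstar Q a)) + max (form_norm \<phi> b) (form_norm \<phi> (qstar Q b))"
    using norm_triangle[of a b] norm_triangle[of "qstar Q a" "qstar Q b"] unfolding star_add by linarith
  show "max (form_norm \<phi> (qscale Q c a)) (form_norm \<phi> (qstar Q (qscale Q c a)))
    = cmod c * max (form_norm \<phi> a) (form_norm \<phi> (qstar Q a))"
    by (simp add: norm_scale star_scale max_mult_distrib_left)
qed

end

locale unital_well_behaved_family = quasi_star_algebra Q for Q :: "'a::ab_group_add quasi" +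
  fixes M :: "'a form set" and e :: 'a
  assumes well_behaved: "strongly_well_behaved Q M" and unit: "quasi_unit Q e"
begin

lemma core_dense_form_member: "\<phi> \<in> M \<Longrightarrow> core_dense_form Q \<phi>"
  using well_behaved by unfold_locales (auto simp: strongly_well_behaved_def)

lemma unit_core: "e \<in> qcore Q" and mul_unit: "qmul Q a e = a" "qmul Q e a = a"
  using unit by (auto simp: quasi_unit_def)

lemma singleton_seminorm_member:
  "\<phi> \<in> M \<Longrightarrow> family_star_seminorm Q {\<phi>} \<in> tau_star_seminorms Q M"
  unfolding tau_star_seminorms_def using bounded_family_singleton by blast

text \<open>
  A single form is a bounded family, so its star seminorm is among those that define the topology.
\<close>

lemma continuous_map_tau_star:
  assumes \<phi>: "\<phi> \<in> M" and g: "\<And>a b. \<bar>g a - g b\<bar> \<le> family_star_seminorm Q {\<phi>} (a - b)"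
  shows "continuous_map (tau_star Q M) euclideanreal g"
proof -
  interpret F: core_dense_form Q \<phi> by (rule core_dense_form_member[OF \<phi>])
  show ?thesis
    unfolding tau_star_def
    by (rule continuous_map_dominated_by_seminorm[OF singleton_seminorm_member[OF \<phi>] _ g])
       (rule seminorm_on_zero[OF F.seminorm_on_family_star_seminorm_singleton vs])
qed

section \<open>Joint continuity of the forms\<close>

lemma form_jointly_continuous:
  assumes \<phi>: "\<phi> \<in> M"
  shows "\<exists>p. seminorm_on (qscale Q) p \<and> continuous_map (tau_star Q M) euclideanreal p \<and>
           (\<forall>a b. cmod (\<phi> a b) \<le> p a * p b)"
proof -
  interpret F: core_dense_form Q \<phi> by (rule core_dense_form_member[OF \<phi>])
  let ?p = "family_star_seminorm Q {\<phi>}"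
  note sn = F.seminorm_on_family_star_seminorm_singleton
  have "cmod (\<phi> a b) \<le> ?p a * ?p b" for a b
  proof -
    have "form_norm \<phi> a * form_norm \<phi> b \<le> ?p a * ?p b"
      using F.norm_nonneg by (intro mult_mono) (auto simp: F.family_star_seminorm_singleton le_max_iff_disj)
    then show ?thesis using F.cauchy_schwarz[of a b] by simp
  qed
  then show ?thesis
    using sn continuous_map_tau_star[OF \<phi> seminorm_on_reverse_triangle[OF sn vs]] by blast
qed


section \<open>Strong* continuity of regular representations\<close>

text \<open>
  The subbasic neighbourhoods are centred at arbitrary operators \<open>X\<close> of \<open>Ldag H D\<close>.  With \<open>\<phi>\<close> the vector
  form of \<open>\<xi>\<close>, the function \<open>g\<close> below, the strong* distance of \<open>\<pi>(a)\<close> to \<open>X\<close> at \<open>\<xi>\<close>, is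
  \<open>1\<close>-Lipschitz for the star seminorm of \<open>\<phi>\<close>; the preimage of the neighbourhood is a sublevel set of
  \<open>g\<close>.
\<close>

lemma regular_rep_continuous:
  fixes H :: "'h::ab_group_add hspace"
  assumes rep: "star_rep Q H D \<pi>" and reg: "regular_rep M H D \<pi>"
  shows "continuous_map (tau_star Q M) (strong_star_topology H D) \<pi>"
proof -
  have dense: "dense_subspace H D" and \<pi>: "\<And>a. \<pi> a \<in> Ldag H D"
    and \<pi>_add: "\<And>a b. \<pi> (a + b) = op_add (\<pi> a) (\<pi> b)"
    and \<pi>_scale: "\<And>c a. \<pi> (qscale Q c a) = op_scale H c (\<pi> a)"
    and \<pi>_star: "\<And>a. \<pi> (qstar Q a) = op_dag H (\<pi> a)"
    using rep by (auto simp: star_rep_def)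
  interpret H: inner_product_space H using rep by (simp add: star_rep_def hilbert_space_def)
  interpret V: vector_space "qscale Q" by (rule vs)
  have \<pi>_diff: "\<pi> (a - b) = op_diff H (\<pi> a) (\<pi> b)" for a b
  proof -
    have "a - b = a + qscale Q (-1) b" by simp
    then show ?thesis by (simp only: \<pi>_add \<pi>_scale op_diff_def)
  qed
  note car = H.Ldag_op_val(2)[OF dense] and dag_car = H.Ldag_op_dag_val(2)[OF dense]
  note val_diff = H.op_val_op_diff[OF dense]
  have "openin (tau_star Q M) (\<pi> -` U \<inter> topspace (tau_star Q M))"
    if "U \<in> insert (Ldag H D) {{Y \<in> Ldag H D. p (op_diff H Y X) < r} | p X r.
        p \<in> {\<lambda>X. max (hnorm H (op_val X \<xi>)) (hnorm H (op_val (op_dag H X) \<xi>)) | \<xi>. \<xi> \<in> D} \<and> X \<in> Ldag H D \<and> 0 < r}"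
    for U
    using that
  proof (elim insertE)
    assume "U = Ldag H D"
    then show ?thesis using \<pi> by (simp add: vimage_def)
  next
    assume "U \<in> {{Y \<in> Ldag H D. p (op_diff H Y X) < r} | p X r.
        p \<in> {\<lambda>X. max (hnorm H (op_val X \<xi>)) (hnorm H (op_val (op_dag H X) \<xi>)) | \<xi>. \<xi> \<in> D} \<and> X \<in> Ldag H D \<and> 0 < r}"
    then obtain \<xi> X r where \<xi>: "\<xi> \<in> D" and X: "X \<in> Ldag H D"
      and U: "U = {Y \<in> Ldag H D.
        max (hnorm H (op_val (op_diff H Y X) \<xi>)) (hnorm H (op_val (op_dag H (op_diff H Y X)) \<xi>)) < r}"
      by blast
    define \<phi> where "\<phi> = (\<lambda>a b. hinner H (op_val (\<pi> a) \<xi>) (op_val (\<pi> b) \<xi>))"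
    have \<phi>: "\<phi> \<in> M" using reg \<xi> by (simp add: regular_rep_def \<phi>_def)
    interpret F: core_dense_form Q \<phi> by (rule core_dense_form_member[OF \<phi>])
    have norm: "form_norm \<phi> a = hnorm H (op_val (\<pi> a) \<xi>)" for a
      by (simp add: \<phi>_def form_norm_def hnorm_def)
    define g where "g a = max (hnorm H (op_val (\<pi> a) \<xi> - op_val X \<xi>))
        (hnorm H (op_val (op_dag H (\<pi> a)) \<xi> - op_val (op_dag H X) \<xi>))" for a
    have "\<bar>g a - g b\<bar> \<le> family_star_seminorm Q {\<phi>} (a - b)" for a b
    proof -
      have "family_star_seminorm Q {\<phi>} (a - b) = max (hnorm H (op_val (\<pi> a) \<xi> - op_val (\<pi> b) \<xi>))
          (hnorm H (op_val (op_dag H (\<pi> a)) \<xi> - op_val (op_dag H (\<pi> b)) \<xi>))"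
        unfolding F.family_star_seminorm_singleton norm \<pi>_star \<pi>_diff
        using val_diff[OF \<pi> \<pi> \<xi>] by simp
      moreover have "\<bar>hnorm H (op_val (\<pi> a) \<xi> - op_val X \<xi>) - hnorm H (op_val (\<pi> b) \<xi> - op_val X \<xi>)\<bar>
          \<le> hnorm H (op_val (\<pi> a) \<xi> - op_val (\<pi> b) \<xi>)"
        using H.hnorm_reverse_triangle[of "op_val (\<pi> a) \<xi> - op_val X \<xi>" "op_val (\<pi> b) \<xi> - op_val X \<xi>"]
          H.carrier_diff car[OF \<pi> \<xi>] car[OF X \<xi>] by simp
      moreover have "\<bar>hnorm H (op_val (op_dag H (\<pi> a)) \<xi> - op_val (op_dag H X) \<xi>)
            - hnorm H (op_val (op_dag H (\<pi> b)) \<xi> - op_val (op_dag H X) \<xi>)\<bar>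
          \<le> hnorm H (op_val (op_dag H (\<pi> a)) \<xi> - op_val (op_dag H (\<pi> b)) \<xi>)"
        using H.hnorm_reverse_triangle[of "op_val (op_dag H (\<pi> a)) \<xi> - op_val (op_dag H X) \<xi>"
            "op_val (op_dag H (\<pi> b)) \<xi> - op_val (op_dag H X) \<xi>"]
          H.carrier_diff dag_car[OF \<pi> \<xi>] dag_car[OF X \<xi>] by simp
      ultimately show ?thesis unfolding g_def by linarith
    qed
    then have "continuous_map (tau_star Q M) euclideanreal g" by (rule continuous_map_tau_star[OF \<phi>])
    then have "openin (tau_star Q M) {a \<in> topspace (tau_star Q M). g a \<in> {..<r}}"
      by (rule openin_continuous_map_preimage) simp
    moreover have "\<pi> -` U \<inter> topspace (tau_star Q M) = {a \<in> topspace (tau_star Q M). g a \<in> {..<r}}"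
      using \<pi> val_diff[OF \<pi> X \<xi>] by (auto simp: U g_def)
    ultimately show ?thesis by simp
  qed
  then show ?thesis
    unfolding strong_star_topology_def seminorm_topology_def
    using \<pi> by (intro continuous_on_generated_topo) auto
qed

section \<open>Bounded elements\<close>

lemma translate_member: "\<phi> \<in> M \<Longrightarrow> x \<in> qcore Q \<Longrightarrow> form_translate Q \<phi> x \<in> M"
  using well_behaved by (simp add: strongly_well_behaved_def sufficient_def balanced_def)

lemma form_norm_translate: "form_norm (form_translate Q \<phi> x) a = form_norm \<phi> (qmul Q a x)"
  by (simp add: form_norm_def form_translate_def)

lemma member_norm_nonneg: "\<phi> \<in> M \<Longrightarrow> 0 \<le> form_norm \<phi> a"
  using core_dense_form.norm_nonneg[OF core_dense_form_member] .

lemma zero_if_norms_zero: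
  assumes "\<And>\<phi>. \<phi> \<in> M \<Longrightarrow> form_norm \<phi> a = 0"
  shows "a = 0"
proof (rule ccontr)
  assume "a \<noteq> 0"
  then obtain \<phi> where "\<phi> \<in> M" "0 < Re (\<phi> a a)"
    using well_behaved by (auto simp: strongly_well_behaved_def sufficient_def)
  then show False using assms[of \<phi>] by (simp add: form_norm_def)
qed

text \<open>
  Since \<open>|ax|\<^sub>\<phi>\<close> and \<open>|x|\<^sub>\<phi>\<close> are the values of the translated form \<open>\<phi>\<^sup>x\<close> at \<open>a\<close> and at the unit, an
  estimate at the unit that is uniform in \<open>\<phi>\<close> holds at all \<open>x\<close>.
\<close>

lemma norm_mul_le:
  assumes "\<And>\<phi>. \<phi> \<in> M \<Longrightarrow> form_norm \<phi> a \<le> K * form_norm \<phi> e" and "\<phi> \<in> M" "x \<in> qcore Q"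
  shows "form_norm \<phi> (qmul Q a x) \<le> K * form_norm \<phi> x"
  using assms(1)[OF translate_member[OF assms(2,3)]] by (simp add: form_norm_translate mul_unit)

text \<open>
  From bilinear to unit: \<open>y\<close> disappears because the core is dense for \<open>\<phi>\<close>, and \<open>x\<close> because the family
  is balanced.  All properties of the norm of bounded elements are derived from this form.
\<close>

lemma is_bound_iff:
  "is_bound Q M a \<gamma> \<longleftrightarrow> 0 < \<gamma> \<and> (\<forall>\<phi>\<in>M. form_norm \<phi> a \<le> \<gamma> * form_norm \<phi> e)"
proof (intro iffI conjI ballI)
  assume b: "is_bound Q M a \<gamma>"
  then show "0 < \<gamma>" by (simp add: is_bound_def)
  fix \<phi> assume \<phi>: "\<phi> \<in> M"
  interpret F: core_dense_form Q \<phi> by (rule core_dense_form_member[OF \<phi>])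
  have "cmod (\<phi> (qmul Q a e) y) \<le> \<gamma> * form_norm \<phi> e * form_norm \<phi> y" if "y \<in> qcore Q" for y
    using b \<phi> unit_core that by (simp only: is_bound_def)
  then show "form_norm \<phi> a \<le> \<gamma> * form_norm \<phi> e"
    using F.norm_le_if_core_bound[of a "\<gamma> * form_norm \<phi> e"] F.norm_nonneg[of e] \<open>0 < \<gamma>\<close>
    by (auto simp: mul_unit)
next
  assume b: "0 < \<gamma> \<and> (\<forall>\<phi>\<in>M. form_norm \<phi> a \<le> \<gamma> * form_norm \<phi> e)"
  show "is_bound Q M a \<gamma>"
    unfolding is_bound_def
  proof (intro conjI ballI)
    fix \<phi> x y assume \<phi>: "\<phi> \<in> M" and x: "x \<in> qcore Q"
    interpret F: core_dense_form Q \<phi> by (rule core_dense_form_member[OF \<phi>])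
    have "form_norm \<phi> (qmul Q a x) * form_norm \<phi> y \<le> (\<gamma> * form_norm \<phi> x) * form_norm \<phi> y"
      using b norm_mul_le[OF _ \<phi> x] F.norm_nonneg by (intro mult_right_mono) auto
    then show "cmod (\<phi> (qmul Q a x) y) \<le> \<gamma> * form_norm \<phi> x * form_norm \<phi> y"
      using F.cauchy_schwarz order_trans by blast
  qed (use b in simp)
qed

abbreviation "B \<equiv> bounded_elements Q M"
abbreviation "bnorm \<equiv> bounded_norm Q M"

lemma bdd_below_bounds: "bdd_below {\<gamma>. is_bound Q M a \<gamma>}"
  by (intro bdd_belowI[of _ 0]) (auto simp: is_bound_def)

text \<open>
  The infimum of the bounds is attained as an inequality.  It can fail to be a bound itself only
  because bounds are required to be positive.
\<close>

lemma norm_le_bounded_norm: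
  assumes a: "a \<in> B" and \<phi>: "\<phi> \<in> M"
  shows "form_norm \<phi> a \<le> bnorm a * form_norm \<phi> e"
proof (cases "form_norm \<phi> e = 0")
  case True
  then show ?thesis using a \<phi> by (auto simp: bounded_elements_def is_bound_iff)
next
  case False
  then have pos: "0 < form_norm \<phi> e" using member_norm_nonneg[OF \<phi>, of e] by simp
  have "form_norm \<phi> a / form_norm \<phi> e \<le> bnorm a"
    unfolding bounded_norm_def
    using a \<phi> pos by (intro cInf_greatest) (auto simp: bounded_elements_def is_bound_iff field_simps)
  then show ?thesis using pos by (simp add: field_simps)
qed

lemma bounded_norm_nonneg: "a \<in> B \<Longrightarrow> 0 \<le> bnorm a"
  unfolding bounded_norm_def
  by (intro cInf_greatest) (auto simp: bounded_elements_def is_bound_iff)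

text \<open>
  The constant \<open>K\<close> may be \<open>0\<close>, whereas bounds are positive; therefore \<open>K + \<epsilon>\<close> is used.
\<close>

lemma bounded_norm_leI:
  assumes "0 \<le> K" "\<And>\<phi>. \<phi> \<in> M \<Longrightarrow> form_norm \<phi> a \<le> K * form_norm \<phi> e"
  shows "a \<in> B" "bnorm a \<le> K"
proof -
  have bound: "is_bound Q M a (K + \<epsilon>)" if "0 < \<epsilon>" for \<epsilon>
    using assms that member_norm_nonneg
    by (auto simp: is_bound_iff distrib_right intro!: order_trans[OF assms(2)])
  show "a \<in> B" using bound[of 1] by (auto simp: bounded_elements_def)
  show "bnorm a \<le> K"
    unfolding bounded_norm_def
    by (rule field_le_epsilon) (use bound bdd_below_bounds in \<open>auto intro: cInf_lower\<close>)
qed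

lemma bounded_mul_le:
  "a \<in> B \<Longrightarrow> \<phi> \<in> M \<Longrightarrow> x \<in> qcore Q \<Longrightarrow> form_norm \<phi> (qmul Q a x) \<le> bnorm a * form_norm \<phi> x"
  by (rule norm_mul_le) (simp_all add: norm_le_bounded_norm)

lemma bounded_zero: "0 \<in> B" "bnorm 0 = 0"
proof -
  have "form_norm \<phi> 0 \<le> 0 * form_norm \<phi> e" if "\<phi> \<in> M" for \<phi>
    using core_dense_form.norm_zero[OF core_dense_form_member[OF that]] by simp
  from bounded_norm_leI[OF order_refl this] bounded_norm_nonneg[of 0]
  show "0 \<in> B" "bnorm 0 = 0" by auto
qed

lemma bounded_norm_eq_0_iff:
  assumes a: "a \<in> B"
  shows "bnorm a = 0 \<longleftrightarrow> a = 0"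
proof
  assume "bnorm a = 0"
  then show "a = 0"
    using norm_le_bounded_norm[OF a] member_norm_nonneg
    by (intro zero_if_norms_zero) (force intro: order_antisym)
qed (simp add: bounded_zero)

lemma bounded_add:
  assumes "a \<in> B" "b \<in> B"
  shows "a + b \<in> B" "bnorm (a + b) \<le> bnorm a + bnorm b"
proof -
  have "form_norm \<phi> (a + b) \<le> (bnorm a + bnorm b) * form_norm \<phi> e" if \<phi>: "\<phi> \<in> M" for \<phi>
    using core_dense_form.norm_triangle[OF core_dense_form_member[OF \<phi>], of a b]
      norm_le_bounded_norm[OF assms(1) \<phi>] norm_le_bounded_norm[OF assms(2) \<phi>]
    by (simp add: distrib_right)
  then show "a + b \<in> B" "bnorm (a + b) \<le> bnorm a + bnorm b"
    using bounded_norm_leI[of "bnorm a + bnorm b"] assms bounded_norm_nonneg by auto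
qed

lemma bounded_scale:
  assumes a: "a \<in> B"
  shows "qscale Q z a \<in> B" "bnorm (qscale Q z a) = cmod z * bnorm a"
proof -
  interpret V: vector_space "qscale Q" by (rule vs)
  have le: "qscale Q z a \<in> B \<and> bnorm (qscale Q z a) \<le> cmod z * bnorm a" if a: "a \<in> B" for z a
  proof -
    have "form_norm \<phi> (qscale Q z a) \<le> (cmod z * bnorm a) * form_norm \<phi> e" if \<phi>: "\<phi> \<in> M" for \<phi>
      using core_dense_form.norm_scale[OF core_dense_form_member[OF \<phi>], of z a]
        mult_left_mono[OF norm_le_bounded_norm[OF a \<phi>], of "cmod z"] by (simp add: mult.assoc)
    then show ?thesis
      using bounded_norm_leI[of "cmod z * bnorm a"] a bounded_norm_nonneg by auto
  qed
  then show B: "qscale Q z a \<in> B" using a by blast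
  have "cmod z * bnorm a \<le> bnorm (qscale Q z a)"
  proof (cases "z = 0")
    case False
    have "bnorm (qscale Q (inverse z) (qscale Q z a)) \<le> cmod (inverse z) * bnorm (qscale Q z a)"
      using le[OF B] by blast
    then show ?thesis using False by (simp add: norm_divide field_simps)
  qed (use bounded_norm_nonneg[OF B] in simp)
  then show "bnorm (qscale Q z a) = cmod z * bnorm a" using le[OF a] by (meson order_antisym)
qed

lemma bounded_diff: "a \<in> B \<Longrightarrow> b \<in> B \<Longrightarrow> a - b \<in> B"
proof -
  interpret V: vector_space "qscale Q" by (rule vs)
  show "a \<in> B \<Longrightarrow> b \<in> B \<Longrightarrow> a - b \<in> B"
    using bounded_add(1)[of a "qscale Q (-1) b"] bounded_scale(1)[of b "-1"] by simp
qed

lemma bounded_star: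
  assumes a: "a \<in> B"
  shows "qstar Q a \<in> B" "bnorm (qstar Q a) = bnorm a"
proof -
  have le: "qstar Q a \<in> B \<and> bnorm (qstar Q a) \<le> bnorm a" if a: "a \<in> B" for a
  proof -
    have "form_norm \<phi> (qstar Q a) \<le> bnorm a * form_norm \<phi> e" if \<phi>: "\<phi> \<in> M" for \<phi>
    proof -
      interpret F: core_dense_form Q \<phi> by (rule core_dense_form_member[OF \<phi>])
      have "cmod (\<phi> (qstar Q a) y) \<le> (bnorm a * form_norm \<phi> e) * form_norm \<phi> y" if y: "y \<in> qcore Q" for y
      proof -
        have "\<phi> (qstar Q a) y = \<phi> e (qmul Q a y)"
          using F.form_mul[OF unit_core y, of "qstar Q a"] by (simp add: mul_unit star_star)
        also have "cmod \<dots> \<le> form_norm \<phi> e * (bnorm a * form_norm \<phi> y)"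
          using F.cauchy_schwarz mult_left_mono[OF bounded_mul_le[OF a \<phi> y] F.norm_nonneg] order_trans by blast
        finally show ?thesis by (simp add: mult_ac)
      qed
      from F.norm_le_if_core_bound[OF this] show ?thesis
        using bounded_norm_nonneg[OF a] F.norm_nonneg[of e] by auto
    qed
    then show ?thesis using bounded_norm_leI[of "bnorm a"] bounded_norm_nonneg[OF a] by blast
  qed
  then show "qstar Q a \<in> B" using a by blast
  then show "bnorm (qstar Q a) = bnorm a" using le[OF a] le[of "qstar Q a"] by (simp add: star_star)
qed


section \<open>The weak multiplication\<close>

lemma is_weak_multD:
  assumes "is_weak_mult Q M a b c" "\<phi> \<in> M" "x \<in> qcore Q" "y \<in> qcore Q"
  shows "\<phi> (qmul Q b x) (qmul Q (qstar Q a) y) = \<phi> (qmul Q c x) y"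
  using assms unfolding is_weak_mult_def by blast

text \<open>
  At \<open>x = e\<close> the defining identity fixes \<open>\<phi>(c, y)\<close> for all \<open>y\<close> in the core, hence the class of \<open>c\<close> in
  every GNS space, and these classes separate points because the family is sufficient.
\<close>

lemma is_weak_mult_unique:
  assumes c: "is_weak_mult Q M a b c" and d: "is_weak_mult Q M a b d"
  shows "c = d"
proof -
  have "form_norm \<phi> (c - d) = 0" if \<phi>: "\<phi> \<in> M" for \<phi>
  proof -
    interpret F: core_dense_form Q \<phi> by (rule core_dense_form_member[OF \<phi>])
    show ?thesis
    proof (rule F.form_eqI)
      fix y assume "y \<in> qcore Q"
      then show "\<phi> c y = \<phi> d y"
        using is_weak_multD[OF c \<phi> unit_core] is_weak_multD[OF d \<phi> unit_core] by (metis mul_unit(1))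
    qed
  qed
  then show ?thesis using zero_if_norms_zero[of "c - d"] by simp
qed

lemma weak_mult_eqI: "is_weak_mult Q M a b c \<Longrightarrow> weak_mult Q M a b = c"
  unfolding weak_mult_def by (rule the_equality) (auto intro: is_weak_mult_unique)

lemma bounded_weak_mult_defined:
  assumes a: "a \<in> B" and b: "b \<in> B"
  shows "weak_mult_defined Q M a b"
proof -
  obtain c where c: "\<And>\<phi>. \<phi> \<in> M \<Longrightarrow>
      weak_prod (gns_space \<phi>) (gns_rep Q \<phi> a) (gns_rep Q \<phi> b) = gns_rep Q \<phi> c"
    using well_behaved a b unfolding strongly_well_behaved_def condition_C_def by metis
  have "is_weak_mult Q M a b c"
    unfolding is_weak_mult_def
    using core_dense_form.weak_mult_if_weak_prod[OF core_dense_form_member c] by blast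
  then show ?thesis by (auto simp: weak_mult_defined_def)
qed

lemma is_weak_mult_weak_mult: "a \<in> B \<Longrightarrow> b \<in> B \<Longrightarrow> is_weak_mult Q M a b (weak_mult Q M a b)"
  using bounded_weak_mult_defined weak_mult_eqI by (metis weak_mult_defined_def)

lemmas weak_multD = is_weak_multD[OF is_weak_mult_weak_mult]

lemma bounded_weak_mult:
  assumes a: "a \<in> B" and b: "b \<in> B"
  shows "weak_mult Q M a b \<in> B" "bnorm (weak_mult Q M a b) \<le> bnorm a * bnorm b"
proof -
  let ?c = "weak_mult Q M a b"
  have K: "0 \<le> bnorm a * bnorm b" using bounded_norm_nonneg a b by simp
  have "form_norm \<phi> ?c \<le> (bnorm a * bnorm b) * form_norm \<phi> e" if \<phi>: "\<phi> \<in> M" for \<phi>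
  proof -
    interpret F: core_dense_form Q \<phi> by (rule core_dense_form_member[OF \<phi>])
    have "cmod (\<phi> ?c y) \<le> ((bnorm a * bnorm b) * form_norm \<phi> e) * form_norm \<phi> y" if y: "y \<in> qcore Q" for y
    proof -
      have "\<phi> ?c y = \<phi> b (qmul Q (qstar Q a) y)"
        using weak_multD[OF a b \<phi> unit_core y] by (simp add: mul_unit)
      also have "cmod \<dots> \<le> form_norm \<phi> b * form_norm \<phi> (qmul Q (qstar Q a) y)" by (rule F.cauchy_schwarz)
      also have "\<dots> \<le> (bnorm b * form_norm \<phi> e) * (bnorm a * form_norm \<phi> y)"
        using norm_le_bounded_norm[OF b \<phi>] bounded_mul_le[OF bounded_star(1)[OF a] \<phi> y]
          bounded_star(2)[OF a] F.norm_nonneg bounded_norm_nonneg[OF b]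
        by (intro mult_mono) auto
      finally show ?thesis by (simp add: mult_ac)
    qed
    from F.norm_le_if_core_bound[OF this] show ?thesis using K F.norm_nonneg[of e] by auto
  qed
  then show "?c \<in> B" "bnorm ?c \<le> bnorm a * bnorm b" using bounded_norm_leI[OF K] by auto
qed

lemma weak_mult_star:
  assumes a: "a \<in> B" and b: "b \<in> B"
  shows "qstar Q (weak_mult Q M a b) = weak_mult Q M (qstar Q b) (qstar Q a)"
proof (rule weak_mult_eqI[symmetric], unfold is_weak_mult_def, intro ballI)
  fix \<phi> x y assume \<phi>: "\<phi> \<in> M" and x: "x \<in> qcore Q" and y: "y \<in> qcore Q"
  interpret F: core_dense_form Q \<phi> by (rule core_dense_form_member[OF \<phi>])
  have "\<phi> (qmul Q (qstar Q a) x) (qmul Q b y) = cnj (\<phi> (qmul Q (weak_mult Q M a b) y) x)"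
    using F.herm weak_multD[OF a b \<phi> y x] by metis
  also have "\<dots> = \<phi> x (qmul Q (weak_mult Q M a b) y)" using F.herm by metis
  also have "\<dots> = \<phi> (qmul Q (qstar Q (weak_mult Q M a b)) x) y"
    using F.form_mul[OF x y, of "qstar Q (weak_mult Q M a b)"] by (simp add: star_star)
  finally show "\<phi> (qmul Q (qstar Q a) x) (qmul Q (qstar Q (qstar Q b)) y)
      = \<phi> (qmul Q (qstar Q (weak_mult Q M a b)) x) y"
    by (simp add: star_star)
qed

text \<open>
  Both sides are compared in \<open>\<phi>((b \<diamond> c)x, a*y) = \<phi>(cx, (a \<diamond> b)*y)\<close>, that is, \<open>b\<close> is moved
  from the left to the right factor past elements \<open>cx\<close> and \<open>a*y\<close> that need not be in the core.
\<close>

lemma weak_mult_assoc: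
  assumes a: "a \<in> B" and b: "b \<in> B" and c: "c \<in> B"
  shows "weak_mult Q M (weak_mult Q M a b) c = weak_mult Q M a (weak_mult Q M b c)"
proof (rule weak_mult_eqI, unfold is_weak_mult_def, intro ballI)
  fix \<phi> x y assume \<phi>: "\<phi> \<in> M" and x: "x \<in> qcore Q" and y: "y \<in> qcore Q"
  interpret F: core_dense_form Q \<phi> by (rule core_dense_form_member[OF \<phi>])
  let ?ab = "weak_mult Q M a b" and ?bc = "weak_mult Q M b c"
  have "\<phi> (qmul Q ?bc x) (qmul Q (qstar Q a) y) = \<phi> (qmul Q c x) (qmul Q (qstar Q ?ab) y)"
  proof (rule F.bounded_adjoint_pairing)
    show "form_norm \<phi> (qmul Q b w) \<le> bnorm b * form_norm \<phi> w" if "w \<in> qcore Q" for w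
      by (rule bounded_mul_le[OF b \<phi> that])
    show "\<phi> (qmul Q ?bc x) w = \<phi> (qmul Q c x) (qmul Q (qstar Q b) w)" if "w \<in> qcore Q" for w
      using weak_multD[OF b c \<phi> x that] by simp
    show "\<phi> (qmul Q (qstar Q ?ab) y) w = \<phi> (qmul Q (qstar Q a) y) (qmul Q b w)" if "w \<in> qcore Q" for w
      using weak_multD[OF bounded_star(1)[OF b] bounded_star(1)[OF a] \<phi> y that]
      by (simp add: weak_mult_star[OF a b] star_star)
  qed
  then show "\<phi> (qmul Q c x) (qmul Q (qstar Q ?ab) y) = \<phi> (qmul Q (weak_mult Q M a ?bc) x) y"
    using weak_multD[OF a bounded_weak_mult(1)[OF b c] \<phi> x y] by simp
qed

text \<open>
  The nontrivial inequality comes from \<open>\<phi>(a, a) = \<phi>(a* \<diamond> a, e)\<close> and the Cauchy-Schwarz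
  inequality.
\<close>

lemma cstar_identity:
  assumes a: "a \<in> B"
  shows "bnorm (weak_mult Q M (qstar Q a) a) = (bnorm a)\<^sup>2"
proof (rule order_antisym)
  let ?c = "weak_mult Q M (qstar Q a) a"
  note s = bounded_star[OF a]
  show "bnorm ?c \<le> (bnorm a)\<^sup>2"
    using bounded_weak_mult(2)[OF s(1) a] s(2) by (simp add: power2_eq_square)
  have c: "?c \<in> B" by (rule bounded_weak_mult(1)[OF s(1) a])
  have "form_norm \<phi> a \<le> sqrt (bnorm ?c) * form_norm \<phi> e" if \<phi>: "\<phi> \<in> M" for \<phi>
  proof -
    interpret F: core_dense_form Q \<phi> by (rule core_dense_form_member[OF \<phi>])
    have "\<phi> a a = \<phi> ?c e"
      using weak_multD[OF s(1) a \<phi> unit_core unit_core] by (simp add: mul_unit star_star)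
    then have "(form_norm \<phi> a)\<^sup>2 = cmod (\<phi> ?c e)"
      using F.norm_sq[of a] by (metis abs_of_nonneg norm_of_real zero_le_power2)
    also have "\<dots> \<le> form_norm \<phi> ?c * form_norm \<phi> e" by (rule F.cauchy_schwarz)
    also have "\<dots> \<le> (bnorm ?c * form_norm \<phi> e) * form_norm \<phi> e"
      using norm_le_bounded_norm[OF c \<phi>] F.norm_nonneg by (intro mult_right_mono)
    also have "\<dots> = (sqrt (bnorm ?c) * form_norm \<phi> e)\<^sup>2"
      using bounded_norm_nonneg[OF c] by (simp add: power2_eq_square mult_ac)
    finally show ?thesis
      by (rule power2_le_imp_le) (simp add: F.norm_nonneg bounded_norm_nonneg[OF c])
  qed
  then have "bnorm a \<le> sqrt (bnorm ?c)" using bounded_norm_nonneg[OF c] by (intro bounded_norm_leI(2)) auto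
  then have "(bnorm a)\<^sup>2 \<le> (sqrt (bnorm ?c))\<^sup>2" by (rule power_mono) (rule bounded_norm_nonneg[OF a])
  then show "(bnorm a)\<^sup>2 \<le> bnorm ?c" using bounded_norm_nonneg[OF c] by simp
qed

lemma weak_mult_bilinear:
  assumes a: "a \<in> B" and b: "b \<in> B" and c: "c \<in> B"
  shows "weak_mult Q M (a + b) c = weak_mult Q M a c + weak_mult Q M b c"
    and "weak_mult Q M a (b + c) = weak_mult Q M a b + weak_mult Q M a c"
    and "weak_mult Q M (qscale Q z a) b = qscale Q z (weak_mult Q M a b)"
    and "weak_mult Q M a (qscale Q z b) = qscale Q z (weak_mult Q M a b)"
proof -
  note simps = core_dense_form.form_simps[OF core_dense_form_member] star_add star_scale
    mul_left_add mul_left_scale is_weak_mult_def weak_multD a b c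
  show "weak_mult Q M (a + b) c = weak_mult Q M a c + weak_mult Q M b c"
    by (rule weak_mult_eqI) (simp add: simps)
  show "weak_mult Q M a (b + c) = weak_mult Q M a b + weak_mult Q M a c"
    by (rule weak_mult_eqI) (simp add: simps)
  show "weak_mult Q M (qscale Q z a) b = qscale Q z (weak_mult Q M a b)"
    by (rule weak_mult_eqI) (simp add: simps)
  show "weak_mult Q M a (qscale Q z b) = qscale Q z (weak_mult Q M a b)"
    by (rule weak_mult_eqI) (simp add: simps)
qed


section \<open>Completeness of the bounded part\<close>

lemma family_star_seminorm_le_bounded_norm:
  assumes F: "F \<subseteq> M" and a: "a \<in> B"
    and e: "\<And>\<phi>. \<phi> \<in> F \<Longrightarrow> form_norm \<phi> e \<le> K" "0 \<le> K"
  shows "family_star_seminorm Q F a \<le> bnorm a * K"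
proof -
  have "form_norm \<phi> b \<le> bnorm a * K" if "\<phi> \<in> F" "b \<in> B" "bnorm b = bnorm a" for \<phi> b
  proof -
    have "form_norm \<phi> b \<le> bnorm b * form_norm \<phi> e" using norm_le_bounded_norm that F by blast
    also have "\<dots> \<le> bnorm a * K" using that e bounded_norm_nonneg[OF a] by (auto intro: mult_left_mono)
    finally show ?thesis .
  qed
  then show ?thesis
    unfolding family_star_seminorm_def
    using a bounded_star[OF a] bounded_norm_nonneg[OF a] e(2) by (auto intro!: family_seminorm_least)
qed

text \<open>
  The limit \<open>a\<close> for the topology of \<open>A\<close> is only known to satisfy \<open>|s\<^sub>m - a|\<^sub>\<phi> \<rightarrow> 0\<close> for each \<open>\<phi>\<close>,
  without uniformity.  Uniformity comes from the Cauchy condition: in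
  \<open>|s\<^sub>n - a|\<^sub>\<phi> \<le> \<parallel>s\<^sub>n - s\<^sub>m\<parallel> |e|\<^sub>\<phi> + |s\<^sub>m - a|\<^sub>\<phi>\<close> the index \<open>m\<close> may depend on \<open>\<phi>\<close>, and then the
  last term disappears.
\<close>

lemma bounded_norm_limit:
  assumes s: "\<And>n. s n \<in> B" and cauchy: "\<And>r. 0 < r \<Longrightarrow> \<exists>N. \<forall>m\<ge>N. \<forall>n\<ge>N. bnorm (s m - s n) < r"
  shows "\<exists>a\<in>B. (\<lambda>n. bnorm (s n - a)) \<longlonglongrightarrow> 0"
proof -
  have complete: "seminorm_complete UNIV (-) (tau_star_seminorms Q M)"
    using well_behaved by (simp add: strongly_well_behaved_def)
  have star_cauchy: "\<exists>N. \<forall>m\<ge>N. \<forall>n\<ge>N. p (s m - s n) < r"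
    if p: "p \<in> tau_star_seminorms Q M" and r: "0 < r" for p r
  proof -
    obtain F where F: "p = family_star_seminorm Q F" "F \<subseteq> M" "bounded_family F"
      using p by (auto simp: tau_star_seminorms_def)
    \<comment> \<open>The maximum with 1 only makes it possible to divide by \<open>K\<close>.\<close>
    define K where "K = max 1 (family_seminorm F e)"
    have K: "0 < K" "\<And>\<phi>. \<phi> \<in> F \<Longrightarrow> form_norm \<phi> e \<le> K"
      using family_seminorm_upper[OF F(3), of _ e] by (auto simp: K_def le_max_iff_disj)
    obtain N where N: "\<forall>m\<ge>N. \<forall>n\<ge>N. bnorm (s m - s n) < r / K" using cauchy[of "r / K"] r K by auto
    have "p (s m - s n) < r" if "N \<le> m" "N \<le> n" for m n
    proof -
      have "p (s m - s n) \<le> bnorm (s m - s n) * K"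
        unfolding F(1) using F(2) K s bounded_diff
        by (intro family_star_seminorm_le_bounded_norm) auto
      also have "\<dots> < r / K * K" using N that K(1) by (intro mult_strict_right_mono) auto
      finally show ?thesis using K(1) by simp
    qed
    then show ?thesis by blast
  qed
  have seminorm_zero: "p 0 = 0" if p: "p \<in> tau_star_seminorms Q M" for p
  proof -
    obtain F where F: "p = family_star_seminorm Q F" "F \<subseteq> M" using p by (auto simp: tau_star_seminorms_def)
    have "form_norm \<phi> 0 = 0" if "\<phi> \<in> F" for \<phi>
      using core_dense_form.norm_zero[OF core_dense_form_member] that F(2) by blast
    then have "(\<lambda>\<phi>. form_norm \<phi> 0) ` F \<subseteq> {0}" by auto
    then have "insert 0 ((\<lambda>\<phi>. form_norm \<phi> 0) ` F) = {0}" by auto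
    then show ?thesis
      by (simp only: F(1) family_star_seminorm_def star_zero family_seminorm_def cSup_singleton max.idem)
  qed
  have "\<exists>a. \<forall>p\<in>tau_star_seminorms Q M. \<forall>r>0. \<exists>N. \<forall>n\<ge>N. p (s n - a) < r"
    by (rule seminorm_complete_sequential_limit[OF complete]) (use star_cauchy seminorm_zero in auto)
  then obtain a where a: "\<And>p r. p \<in> tau_star_seminorms Q M \<Longrightarrow> 0 < r \<Longrightarrow> \<exists>N. \<forall>n\<ge>N. p (s n - a) < r"
    by metis
  have est: "s n - a \<in> B \<and> bnorm (s n - a) \<le> r"
    if r: "0 \<le> r" and N: "\<And>m. N \<le> m \<Longrightarrow> bnorm (s n - s m) \<le> r" for n N r
  proof -
    have "form_norm \<phi> (s n - a) \<le> r * form_norm \<phi> e" if \<phi>: "\<phi> \<in> M" for \<phi>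
    proof (rule field_le_epsilon)
      fix \<epsilon> :: real assume \<epsilon>: "0 < \<epsilon>"
      interpret F: core_dense_form Q \<phi> by (rule core_dense_form_member[OF \<phi>])
      obtain N' where N': "\<forall>m\<ge>N'. family_star_seminorm Q {\<phi>} (s m - a) < \<epsilon>"
        using a[OF singleton_seminorm_member[OF \<phi>] \<epsilon>] by blast
      define m where "m = max N N'"
      have "form_norm \<phi> (s n - a) \<le> form_norm \<phi> (s n - s m) + form_norm \<phi> (s m - a)"
        using F.norm_triangle[of "s n - s m" "s m - a"] by simp
      also have "form_norm \<phi> (s n - s m) \<le> bnorm (s n - s m) * form_norm \<phi> e"
        using norm_le_bounded_norm \<phi> s bounded_diff by blast
      also have "\<dots> \<le> r * form_norm \<phi> e" using N[of m] F.norm_nonneg by (intro mult_right_mono) (auto simp: m_def)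
      also have "form_norm \<phi> (s m - a) \<le> \<epsilon>"
        using N'[rule_format, of m] by (simp add: m_def F.family_star_seminorm_singleton)
      finally show "form_norm \<phi> (s n - a) \<le> r * form_norm \<phi> e + \<epsilon>" by simp
    qed
    then show ?thesis using bounded_norm_leI[OF r] by blast
  qed
  have lim: "\<exists>N. \<forall>n\<ge>N. s n - a \<in> B \<and> bnorm (s n - a) \<le> r" if r: "0 < r" for r
  proof -
    obtain N where N: "\<forall>m\<ge>N. \<forall>n\<ge>N. bnorm (s m - s n) < r" using cauchy[OF r] by blast
    have "s n - a \<in> B \<and> bnorm (s n - a) \<le> r" if "N \<le> n" for n
      using N that r by (intro est[of r N n]) (auto intro: less_imp_le)
    then show ?thesis by blast
  qed
  obtain k where "s k - a \<in> B" using lim[of 1] by auto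
  then have aB: "a \<in> B" using bounded_diff[OF s[of k], of "s k - a"] by simp
  have "(\<lambda>n. bnorm (s n - a)) \<longlonglongrightarrow> 0"
  proof (rule LIMSEQ_I)
    fix r :: real assume r: "0 < r"
    obtain N where "\<forall>n\<ge>N. s n - a \<in> B \<and> bnorm (s n - a) \<le> r / 2" using lim[of "r / 2"] r by auto
    then show "\<exists>N. \<forall>n\<ge>N. norm (bnorm (s n - a) - 0) < r"
      using r bounded_norm_nonneg by (intro exI[of _ N]) fastforce
  qed
  then show ?thesis using aB by blast
qed

lemma Metric_space_bounded: "Metric_space B (norm_dist B bnorm)"
proof
  interpret V: vector_space "qscale Q" by (rule vs)
  have minus: "bnorm (a - b) = bnorm (b - a)" if "a \<in> B" "b \<in> B" for a b
    using bounded_scale(2)[OF bounded_diff[OF that], of "-1"] by simp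
  show "0 \<le> norm_dist B bnorm a b" for a b
    by (simp add: norm_dist_def bounded_norm_nonneg bounded_diff)
  show "norm_dist B bnorm a b = norm_dist B bnorm b a" for a b
    using minus by (simp add: norm_dist_def)
  show "norm_dist B bnorm a b = 0 \<longleftrightarrow> a = b" if "a \<in> B" "b \<in> B" for a b
    using that by (simp add: norm_dist_def bounded_norm_eq_0_iff bounded_diff)
  show "norm_dist B bnorm a c \<le> norm_dist B bnorm a b + norm_dist B bnorm b c"
    if "a \<in> B" "b \<in> B" "c \<in> B" for a b c
    using that bounded_add(2)[of "a - b" "b - c"] by (simp add: norm_dist_def bounded_diff)
qed

lemma mcomplete_bounded: "Metric_space.mcomplete B (norm_dist B bnorm)"
proof -
  interpret X: Metric_space B "norm_dist B bnorm" by (rule Metric_space_bounded)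
  have "\<exists>a. limitin X.mtopology s a sequentially" if "X.MCauchy s" for s
  proof -
    have s: "s n \<in> B" for n using that by (auto simp: X.MCauchy_def)
    have "\<exists>N. \<forall>m\<ge>N. \<forall>n\<ge>N. bnorm (s m - s n) < r" if r: "0 < r" for r
      using \<open>X.MCauchy s\<close> r s unfolding X.MCauchy_def norm_dist_def by simp
    then obtain a where "a \<in> B" "(\<lambda>n. bnorm (s n - a)) \<longlonglongrightarrow> 0" using bounded_norm_limit[of s, OF s] by blast
    then show ?thesis
      using s by (intro exI[of _ a]) (simp add: X.limitin_metric_dist_null norm_dist_def)
  qed
  then show ?thesis by (simp add: X.mcomplete_def)
qed

lemma cstar_algebra_bounded: "cstar_algebra (qscale Q) B (weak_mult Q M) (qstar Q) bnorm"
proof -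
  interpret V: vector_space "qscale Q" by (rule vs)
  show ?thesis
  proof
    show "V.subspace B" by (rule V.subspaceI) (simp_all add: bounded_zero bounded_add bounded_scale)
  qed (simp_all add: bounded_weak_mult weak_mult_assoc weak_mult_bilinear bounded_star star_star star_add
      star_scale weak_mult_star bounded_norm_nonneg bounded_norm_eq_0_iff bounded_add bounded_scale
      cstar_identity mcomplete_bounded)
qed

end

theorem theorem6p6:
  fixes Q :: "'a::ab_group_add quasi" and \<tau> :: "'a topology" and M :: "'a form set"
  assumes "lc_quasi_GA_star_algebra Q \<tau>"
    and "\<exists>e. quasi_unit Q e"
    and "strongly_well_behaved Q M"
    and "\<tau> = tau_star Q M"
  shows "(\<forall>\<phi>\<in>M. \<exists>p. seminorm_on (qscale Q) p \<and> continuous_map \<tau> euclideanreal p \<and>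
                   (\<forall>a b. cmod (\<phi> a b) \<le> p a * p b)) \<and>
         (\<forall>(H :: 'h::ab_group_add hspace) D \<pi>.
            star_rep Q H D \<pi> \<and> regular_rep M H D \<pi> \<longrightarrow>
            continuous_map \<tau> (strong_star_topology H D) \<pi>) \<and>
         (\<forall>a\<in>bounded_elements Q M. \<forall>b\<in>bounded_elements Q M. weak_mult_defined Q M a b) \<and>
         cstar_algebra (qscale Q) (bounded_elements Q M) (weak_mult Q M) (qstar Q) (bounded_norm Q M)"
proof -
  obtain e where "quasi_unit Q e" using assms(2) by blast
  with assms(1,3) interpret unital_well_behaved_family Q M e
    by (simp add: unital_well_behaved_family_def unital_well_behaved_family_axioms_def
        lc_quasi_GA_star_algebra_def lc_quasi_star_algebra_def)
  show ?thesis
    unfolding \<open>\<tau> = tau_star Q M\<close>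
    using form_jointly_continuous regular_rep_continuous bounded_weak_mult_defined cstar_algebra_bounded
    by blast
qed

end
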